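(* Let $\mathbb{K}$ be a field, let $p,q\in\mathbb{K}^{\ast}$ be such that neither $p$ nor $q$ is a root of unity, and let $A_{\mathbb{S}}=(\mathcal{A}_p(1,1,\mathbb{K}_q[s,t]))_{\mathbb{S}}$. Any $\mathbb{K}$-algebra automorphism of $A_{\mathbb{S}}$ is either of positive type or the composition $\psi_-^{-1}\circ\varphi_+$ of a $\mathbb{K}$-algebra automorphism $\varphi_+$ of $A_{\mathbb{S}}$ of positive type with the negative automorphism $\psi_-^{-1}$, where $\psi_-$ is the automorphism of $A_{\mathbb{S}}$ given by $$\psi_-(x)=y,\quad \psi_-(y)=-p^{-1}z^{-1}x,\quad \psi_-(z)=p^{-1}z^{-1},\quad \psi_-(s)=s,\quad \psi_-(t)=t.$$ In particular, letting $G_+\subseteq\mathrm{Aut}_{\mathbb{K}}(A_{\mathbb{S}})$ be the subgroup of automorphisms of positive type and $G_-=\{\psi_-^{-1}\circ\varphi_+\mid\varphi_+\in G_+\}$, we have a disjoint union $$\mathrm{Aut}_{\mathbb{K}}(A_{\mathbb{S}})=G_+\sqcup G_-$$ and a short exact sequence of groups $$1\longrightarrow G_+\longrightarrow \mathrm{Aut}_{\mathbb{K}}(A_{\mathbb{S}})\longrightarrow\mathbb{Z}_2\longrightarrow 1,$$ where $G_+\to\mathrm{Aut}_{\mathbb{K}}(A_{\mathbb{S}})$ is the inclusion.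
   Context: $\mathcal{A}_p(1,1,\mathbb{K}_q[s,t])$ denotes the associative unital $\mathbb{K}$-algebra generated by $x,y,s,t$ subject to the relations $$xy-pyx=1,\quad st=qts,\quad sx=xs,\quad sy=ys,\quad tx=xt,\quad ty=yt.$$ Put $z:=xy-yx$; then $xz=pzx$, $yz=p^{-1}zy$, $sz=zs$, $tz=zt$. The subscript $\mathbb{S}$ denotes the Ore localization at $\mathbb{S}=\{z^is^jt^k\mid i,j,k\in\mathbb{Z}_{\ge0}\}$ (up to nonzero scalars), i.e. $z,s,t$ are inverted. A $\mathbb{K}$-algebra endomorphism $\varphi$ of $A_{\mathbb{S}}$ is of positive type (positive) if $\varphi(z)=\alpha z$ for some $\alpha\in\mathbb{K}^{\ast}$, and of negative type (negative) if $\varphi(z)=\alpha z^{-1}$ for some $\alpha\in\mathbb{K}^{\ast}$. $\mathbb{Z}_2$ is the cyclic group of order $2$. The number $1$ counts as a root of unity. *)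

theory Defs
  imports
    Complex_Main
    "HOL-Library.Poly_Mapping"
    "HOL-Algebra.Elementary_Groups"
begin

section \<open>Unital associative algebras over a field\<close>

locale k_algebra = vector_space scale
  for scale :: "'k::field \<Rightarrow> 'a::ring_1 \<Rightarrow> 'a" +
  assumes scale_mult_left: "scale c a * b = scale c (a * b)"
    and scale_mult_right: "a * scale c b = scale c (a * b)"

locale k_algebra_hom = dom: k_algebra scale1 + cod: k_algebra scale2
  for scale1 :: "'k::field \<Rightarrow> 'a::ring_1 \<Rightarrow> 'a"
    and scale2 :: "'k::field \<Rightarrow> 'b::ring_1 \<Rightarrow> 'b" +
  fixes f :: "'a \<Rightarrow> 'b"
  assumes hom_add: "f (a + b) = f a + f b"
    and hom_scale: "f (scale1 c a) = scale2 c (f a)"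
    and hom_mult: "f (a * b) = f a * f b"
    and hom_one: "f 1 = 1"

definition algebra_Aut :: "('k::field \<Rightarrow> 'a::ring_1 \<Rightarrow> 'a) \<Rightarrow> ('a \<Rightarrow> 'a) monoid" where
  "algebra_Aut scale =
     \<lparr>carrier = {\<phi>. k_algebra_hom scale scale \<phi> \<and> bij \<phi>}, monoid.mult = (\<circ>), one = id\<rparr>"

section \<open>Free algebras and presentations\<close>

text \<open>
  The free algebra on a set of generators \<open>'g\<close> is the monoid algebra of the free monoid of words
  over \<open>'g\<close>. The product of polynomial mappings is convolution with respect to the operation \<open>+\<close>
  of the index type, so concatenation of words has to be written additively.
\<close>

datatype 'g word = Word (letters: "'g list")

instantiation word :: (type) monoid_add
begin
definition zero_word :: "'a word" where "zero_word = Word []"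
definition plus_word :: "'a word \<Rightarrow> 'a word \<Rightarrow> 'a word" where
  "plus_word u v = Word (letters u @ letters v)"
instance by standard (simp_all add: zero_word_def plus_word_def)
end

type_synonym ('g, 'k) free_algebra = "'g word \<Rightarrow>\<^sub>0 'k"

definition free_gen :: "'g \<Rightarrow> ('g, 'k::field) free_algebra" where
  "free_gen g = Poly_Mapping.single (Word [g]) 1"

definition free_scale :: "'k::field \<Rightarrow> ('g, 'k) free_algebra \<Rightarrow> ('g, 'k) free_algebra" where
  "free_scale c f = Poly_Mapping.single 0 c * f"

lemma single_zero_commute:
  "Poly_Mapping.single 0 c * f = f * Poly_Mapping.single 0 c"
  for f :: "('g, 'k::field) free_algebra"
proof (induction f rule: update_induct)
  case (update f a b)
  then have "Poly_Mapping.update a b f = Poly_Mapping.single a b + f"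
    by (intro poly_mapping_eqI)
      (auto simp: lookup_update lookup_add lookup_single when_def in_keys_iff)
  with update show ?case
    by (simp add: algebra_simps mult_single)
qed simp

lemma k_algebra_free_scale:
  "k_algebra (free_scale :: 'k::field \<Rightarrow> ('g, 'k) free_algebra \<Rightarrow> ('g, 'k) free_algebra)"
proof
  fix c d :: 'k and f g :: "('g, 'k) free_algebra"
  show "free_scale c (f + g) = free_scale c f + free_scale c g"
    by (simp add: free_scale_def algebra_simps)
  show "free_scale (c + d) f = free_scale c f + free_scale d f"
    by (simp add: free_scale_def single_add algebra_simps)
  show "free_scale c (free_scale d f) = free_scale (c * d) f"
    by (simp add: free_scale_def mult_single flip: mult.assoc)
  show "free_scale 1 f = f"
    by (simp add: free_scale_def)
  show "free_scale c f * g = free_scale c (f * g)"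
    by (simp add: free_scale_def mult.assoc)
  show "f * free_scale c g = free_scale c (f * g)"
    unfolding free_scale_def by (metis mult.assoc single_zero_commute)
qed

definition two_sided_ideal :: "'r::ring_1 set \<Rightarrow> bool" where
  "two_sided_ideal I \<longleftrightarrow>
     0 \<in> I \<and> (\<forall>a\<in>I. \<forall>b\<in>I. a + b \<in> I) \<and> (\<forall>a\<in>I. \<forall>r. r * a \<in> I \<and> a * r \<in> I)"

text \<open>
  The algebra is generated by the family \<open>gens\<close> subject to the relations \<open>r = 0\<close>, \<open>r \<in> R\<close>:
  up to isomorphism it is the free algebra modulo the two-sided ideal generated by \<open>R\<close>.
\<close>

definition presented_by ::
  "('k::field \<Rightarrow> 'a::ring_1 \<Rightarrow> 'a) \<Rightarrow> ('g \<Rightarrow> 'a) \<Rightarrow> ('g, 'k) free_algebra set \<Rightarrow> bool" where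
  "presented_by scale gens R \<longleftrightarrow>
     (\<exists>\<pi>. k_algebra_hom free_scale scale \<pi> \<and> (\<forall>g. \<pi> (free_gen g) = gens g) \<and>
          surj \<pi> \<and> {f. \<pi> f = 0} = two_sided_ideal hull R)"

section \<open>The algebra $A_p(1,1,K_q[s,t])$\<close>

datatype xyst = GX | GY | GS | GT

definition A_relators :: "'k::field \<Rightarrow> 'k \<Rightarrow> (xyst, 'k) free_algebra set" where
  "A_relators p q =
    (let X = free_gen GX; Y = free_gen GY; S = free_gen GS; T = free_gen GT in
     {X * Y - free_scale p (Y * X) - 1,
      S * T - free_scale q (T * S),
      S * X - X * S, S * Y - Y * S, T * X - X * T, T * Y - Y * T})"

definition is_A ::
  "'k::field \<Rightarrow> 'k \<Rightarrow> ('k \<Rightarrow> 'a::ring_1 \<Rightarrow> 'a) \<Rightarrow> 'a \<Rightarrow> 'a \<Rightarrow> 'a \<Rightarrow> 'a \<Rightarrow> bool" where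
  "is_A p q scale x y s t \<longleftrightarrow>
     presented_by scale (\<lambda>g. case g of GX \<Rightarrow> x | GY \<Rightarrow> y | GS \<Rightarrow> s | GT \<Rightarrow> t) (A_relators p q)"

section \<open>Ore localization\<close>

definition ring_unit :: "'a::ring_1 \<Rightarrow> bool" where
  "ring_unit u \<longleftrightarrow> (\<exists>v. u * v = 1 \<and> v * u = 1)"

definition ring_inv :: "'a::ring_1 \<Rightarrow> 'a" where
  "ring_inv u = (THE v. u * v = 1 \<and> v * u = 1)"

text \<open>
  \<open>\<iota>\<close> exhibits its codomain as the right ring of fractions with respect to \<open>S\<close>, in the usual sense:
  elements of \<open>S\<close> become invertible, every element is a fraction \<open>\<iota> a (\<iota> d)\<^sup>-\<^sup>1\<close>, and the kernel is the
  \<open>S\<close>-torsion. This determines the codomain up to a unique isomorphism compatible with \<open>\<iota>\<close>.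
\<close>

definition is_ore_localization ::
  "('k::field \<Rightarrow> 'a::ring_1 \<Rightarrow> 'a) \<Rightarrow> ('k \<Rightarrow> 'l::ring_1 \<Rightarrow> 'l) \<Rightarrow> 'a set \<Rightarrow> ('a \<Rightarrow> 'l) \<Rightarrow> bool" where
  "is_ore_localization scaleA scaleL S \<iota> \<longleftrightarrow>
     k_algebra_hom scaleA scaleL \<iota> \<and>
     (\<forall>d\<in>S. ring_unit (\<iota> d)) \<and>
     (\<forall>b. \<exists>a. \<exists>d\<in>S. b = \<iota> a * ring_inv (\<iota> d)) \<and>
     (\<forall>a. \<iota> a = 0 \<longleftrightarrow> (\<exists>d\<in>S. a * d = 0))"

text \<open>
  The nonzero scalars make the set multiplicatively closed, since \<open>s\<close> and \<open>t\<close> only \<open>q\<close>-commute.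
\<close>

definition zst_monomials :: "('k::field \<Rightarrow> 'a::ring_1 \<Rightarrow> 'a) \<Rightarrow> 'a \<Rightarrow> 'a \<Rightarrow> 'a \<Rightarrow> 'a set" where
  "zst_monomials scale z s t = {scale c (z ^ i * s ^ j * t ^ k) | c i j k. c \<noteq> 0}"

section \<open>Positive and negative automorphisms\<close>

definition positive_type :: "('k::field \<Rightarrow> 'l::ring_1 \<Rightarrow> 'l) \<Rightarrow> 'l \<Rightarrow> ('l \<Rightarrow> 'l) \<Rightarrow> bool" where
  "positive_type scale z \<phi> \<longleftrightarrow> (\<exists>\<alpha>. \<alpha> \<noteq> 0 \<and> \<phi> z = scale \<alpha> z)"

definition negative_type :: "('k::field \<Rightarrow> 'l::ring_1 \<Rightarrow> 'l) \<Rightarrow> 'l \<Rightarrow> ('l \<Rightarrow> 'l) \<Rightarrow> bool" where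
  "negative_type scale z \<phi> \<longleftrightarrow> (\<exists>\<alpha>. \<alpha> \<noteq> 0 \<and> \<phi> z = scale \<alpha> (ring_inv z))"

definition G_plus :: "('k::field \<Rightarrow> 'l::ring_1 \<Rightarrow> 'l) \<Rightarrow> 'l \<Rightarrow> ('l \<Rightarrow> 'l) set" where
  "G_plus scale z = {\<phi> \<in> carrier (algebra_Aut scale). positive_type scale z \<phi>}"

definition G_minus ::
  "('k::field \<Rightarrow> 'l::ring_1 \<Rightarrow> 'l) \<Rightarrow> 'l \<Rightarrow> ('l \<Rightarrow> 'l) \<Rightarrow> ('l \<Rightarrow> 'l) set" where
  "G_minus scale z \<psi> = {inv_into UNIV \<psi> \<circ> \<phi> | \<phi>. \<phi> \<in> G_plus scale z}"

definition is_psi_minus ::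
  "'k::field \<Rightarrow> ('k \<Rightarrow> 'l::ring_1 \<Rightarrow> 'l) \<Rightarrow> 'l \<Rightarrow> 'l \<Rightarrow> 'l \<Rightarrow> 'l \<Rightarrow> 'l \<Rightarrow> ('l \<Rightarrow> 'l) \<Rightarrow> bool" where
  "is_psi_minus p scale x y z s t \<psi> \<longleftrightarrow>
     \<psi> \<in> carrier (algebra_Aut scale) \<and>
     \<psi> x = y \<and>
     \<psi> y = scale (- inverse p) (ring_inv z * x) \<and>
     \<psi> z = scale (inverse p) (ring_inv z) \<and>
     \<psi> s = s \<and> \<psi> t = t"

text \<open>
  Exactness of \<open>1 \<rightarrow> N \<rightarrow> G \<rightarrow> Q \<rightarrow> 1\<close>. The library's \<open>short_exact_sequence\<close> is not used because it
  forces the three groups to have the same element type.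
\<close>

definition short_exact ::
  "('a, 'm) monoid_scheme \<Rightarrow> ('b, 'n) monoid_scheme \<Rightarrow> ('c, 'o) monoid_scheme \<Rightarrow>
   ('a \<Rightarrow> 'b) \<Rightarrow> ('b \<Rightarrow> 'c) \<Rightarrow> bool" where
  "short_exact N G Q f g \<longleftrightarrow>
     group N \<and> group G \<and> group Q \<and> f \<in> mon N G \<and> g \<in> epi G Q \<and>
     f ` carrier N = kernel G Q g"

end

theory Submission
  imports Defs "HOL-Library.Product_Plus" "HOL-Library.Product_Lexorder"
    "HOL-Computational_Algebra.Polynomial"
begin

text \<open>
  Call the localized algebra \<open>L\<close>. Everything rests on its group of units. The algebra is graded by
  \<open>\<int>\<^sup>3\<close>: the degree of a monomial counts \<open>x\<close> (with \<open>y\<close> counting negatively), \<open>s\<close> and \<open>t\<close>. Conjugation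
  by \<open>z\<close>, \<open>t\<close> and \<open>s\<close> multiplies a homogeneous element by powers of \<open>p\<close> and \<open>q\<close> that determine its degree,
  because neither \<open>p\<close> nor \<open>q\<close> is a root of unity; so the components are independent
  (\<open>simultaneous_eigenvectors_independent\<close>). The relations express \<open>x y\<close> and \<open>y x\<close> as linear
  polynomials in \<open>z\<close>, so each component consists of the multiples of a single monomial by Laurent
  polynomials in \<open>z\<close> (\<open>homogeneous_eq_monomials\<close>). As \<open>z\<close> is transcendental over the field
  (\<open>ev_eq_0_iff\<close>), products of nonzero homogeneous elements are nonzero.

  Now \<open>\<int>\<^sup>3\<close> is an ordered group, and comparing the largest and the smallest degrees occurring in a unit
  and in its inverse shows that units are homogeneous (\<open>units_homogeneous\<close>). Moreover \<open>x\<close> has no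
  left inverse, since \<open>y x\<close> vanishes at \<open>z = 1\<close>. Hence units have degree \<open>0\<close> in \<open>x\<close> and commute with \<open>z\<close>: the
  element \<open>z\<close> is central in the group of units. An automorphism \<open>\<phi>\<close> preserves this centre, whose elements
  commute with \<open>z\<close>, \<open>s\<close> and \<open>t\<close> and so have degree \<open>0\<close>; therefore \<open>\<phi>(z)\<close> is a scalar multiple of some \<open>z\<^sup>i\<close>.
  The same holds for \<open>\<phi>\<^sup>-\<^sup>1\<close>, which leaves only \<open>i = 1\<close> and \<open>i = -1\<close> (\<open>automorphism_type\<close>).

  These exponents multiply under composition, so the sign is a homomorphism to \<open>\<int>\<^sub>2\<close> with the positive
  automorphisms as its kernel. It is surjective because \<open>\<psi>\<^sub>-\<close> exists (\<open>psi_minus_exists\<close>): the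
  images of \<open>x\<close>, \<open>y\<close>, \<open>s\<close>, \<open>t\<close> satisfy the defining relations and send \<open>z\<close> to a unit, so the presentation
  and the universal property of the localization (\<open>ore_localization_extend\<close>) supply an
  endomorphism, and its inverse arises in the same way.
\<close>

section \<open>Algebras given by generators and relations\<close>

lemma (in k_algebra) scale_one_mult: "scale c 1 * a = scale c a"
  by (simp add: scale_mult_left)

lemma (in k_algebra) mult_scale_one: "a * scale c 1 = scale c a"
  by (simp add: scale_mult_right)

lemma (in k_algebra_hom) hom_zero: "f 0 = 0"
  using hom_add[of 0 0] by simp

lemma (in k_algebra_hom) hom_uminus: "f (- a) = - f a"
  using hom_add[of a "- a"] by (simp add: hom_zero eq_neg_iff_add_eq_0 add.commute)

lemma (in k_algebra_hom) hom_diff: "f (a - b) = f a - f b"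
  using hom_add[of a "- b"] by (simp add: hom_uminus)

lemma (in k_algebra_hom) hom_power: "f (a ^ n) = f a ^ n"
  by (induction n) (simp_all add: hom_one hom_mult)

lemmas (in k_algebra_hom) hom_simps =
  hom_zero hom_one hom_add hom_uminus hom_diff hom_mult hom_scale hom_power

lemma k_algebra_homI:
  assumes "k_algebra scaleA" "k_algebra scaleB"
    and "\<And>a b. f (a + b) = f a + f b" "\<And>c a. f (scaleA c a) = scaleB c (f a)"
    and "\<And>a b. f (a * b) = f a * f b" "f 1 = 1"
  shows "k_algebra_hom scaleA scaleB f"
  using assms by (intro k_algebra_hom.intro k_algebra_hom_axioms.intro) auto

lemma k_algebra_hom_comp:
  assumes "k_algebra_hom scaleA scaleB f" "k_algebra_hom scaleB scaleC g"
  shows "k_algebra_hom scaleA scaleC (g \<circ> f)"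
proof -
  interpret f: k_algebra_hom scaleA scaleB f by fact
  interpret g: k_algebra_hom scaleB scaleC g by fact
  show ?thesis
    by (rule k_algebra_homI)
       (simp_all add: f.hom_simps g.hom_simps f.dom.k_algebra_axioms g.cod.k_algebra_axioms)
qed

lemma k_algebra_hom_inv:
  assumes "k_algebra_hom scale scale \<phi>" "bij \<phi>"
  shows "k_algebra_hom scale scale (inv_into UNIV \<phi>)" "bij (inv_into UNIV \<phi>)"
proof -
  interpret \<phi>: k_algebra_hom scale scale \<phi> by fact
  have \<phi>_inv: "\<phi> (inv_into UNIV \<phi> a) = a" for a
    using assms(2) by (simp add: bij_is_surj surj_f_inv_f)
  have inj: "a = b" if "\<phi> a = \<phi> b" for a b
    using that bij_is_inj[OF assms(2)] by (auto dest: injD)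
  show "k_algebra_hom scale scale (inv_into UNIV \<phi>)"
    by (rule k_algebra_homI[OF \<phi>.dom.k_algebra_axioms \<phi>.dom.k_algebra_axioms]; rule inj)
       (simp_all add: \<phi>_inv \<phi>.hom_simps)
  show "bij (inv_into UNIV \<phi>)"
    by (rule bij_imp_bij_inv[OF assms(2)])
qed

lemma single_word_Cons:
  "Poly_Mapping.single (Word (g # w)) 1 = free_gen g * Poly_Mapping.single (Word w) (1 :: 'k::field)"
  by (simp add: free_gen_def mult_single plus_word_def)

lemma free_scale_single:
  "free_scale c (Poly_Mapping.single w d) = Poly_Mapping.single w (c * d)"
  by (simp add: free_scale_def mult_single)

lemma free_algebra_induct [case_names zero add single]:
  fixes f :: "('g, 'k::field) free_algebra"
  assumes zero: "P 0"
    and add: "\<And>f g. P f \<Longrightarrow> P g \<Longrightarrow> P (f + g)"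
    and single: "\<And>w c. P (Poly_Mapping.single w c)"
  shows "P f"
proof (induction f rule: update_induct)
  case (update f a b)
  then have "Poly_Mapping.update a b f = Poly_Mapping.single a b + f"
    by (intro poly_mapping_eqI)
      (auto simp: lookup_update lookup_add lookup_single when_def in_keys_iff)
  then show ?case
    using add[OF single update.IH] by simp
qed (rule zero)

context k_algebra
begin

definition free_eval :: "('g \<Rightarrow> 'a) \<Rightarrow> ('g, 'k) free_algebra \<Rightarrow> 'a" where
  "free_eval h f = (\<Sum>w\<in>Poly_Mapping.keys f.
     scale (Poly_Mapping.lookup f w) (prod_list (map h (letters w))))"

lemma free_eval_superset:
  assumes "finite W" "Poly_Mapping.keys f \<subseteq> W"
  shows "free_eval h f =
    (\<Sum>w\<in>W. scale (Poly_Mapping.lookup f w) (prod_list (map h (letters w))))"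
  unfolding free_eval_def using assms
  by (intro sum.mono_neutral_left) (auto simp: in_keys_iff)

lemma free_eval_add: "free_eval h (f + g) = free_eval h f + free_eval h g"
proof -
  let ?W = "Poly_Mapping.keys f \<union> Poly_Mapping.keys g"
  have "Poly_Mapping.keys (f + g) \<subseteq> ?W"
    by (rule keys_add)
  then show ?thesis
    by (simp add: free_eval_superset[of ?W] lookup_add scale_left_distrib sum.distrib)
qed

lemma free_eval_zero: "free_eval h 0 = 0"
  by (simp add: free_eval_def)

lemma free_eval_single:
  "free_eval h (Poly_Mapping.single w c) = scale c (prod_list (map h (letters w)))"
  by (subst free_eval_superset[of "{w}"]) auto

lemma free_eval_mult: "free_eval h (f * g) = free_eval h f * free_eval h g"
proof (induction f rule: free_algebra_induct)
  case (single u c)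
  show ?case
  proof (induction g rule: free_algebra_induct)
    case (single v d)
    show ?case
      by (simp add: mult_single free_eval_single plus_word_def scale_mult_left scale_mult_right)
  qed (simp_all add: free_eval_zero free_eval_add distrib_left)
qed (simp_all add: free_eval_zero free_eval_add distrib_right)

lemma free_eval_scale: "free_eval h (free_scale c f) = scale c (free_eval h f)"
  by (simp add: free_scale_def free_eval_mult free_eval_single zero_word_def scale_one_mult)

lemma free_eval_gen: "free_eval h (free_gen g) = h g"
  by (simp add: free_gen_def free_eval_single)

lemma free_eval_one: "free_eval h 1 = 1"
  by (simp flip: single_one add: free_eval_single zero_word_def)

lemma k_algebra_hom_free_eval: "k_algebra_hom free_scale scale (free_eval h)"
  by (intro k_algebra_homI k_algebra_axioms k_algebra_free_scale
      free_eval_add free_eval_scale free_eval_mult free_eval_one)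

end

lemma two_sided_ideal_kernel:
  assumes "k_algebra_hom scaleA scaleB f"
  shows "two_sided_ideal {a. f a = 0}"
proof -
  interpret k_algebra_hom scaleA scaleB f by fact
  show ?thesis
    by (simp add: two_sided_ideal_def hom_simps)
qed

lemma presented_by_k_algebra:
  assumes "presented_by scaleA gens R"
  shows "k_algebra scaleA"
  using assms by (auto simp: presented_by_def k_algebra_hom_def)

text \<open>The evaluation map of the free algebra kills the ideal generated by the relators as soon as
  it kills the relators, because its kernel is a two-sided ideal; hence it factors.\<close>

lemma presented_by_hom_exists:
  assumes A: "presented_by scaleA gens R" and B: "k_algebra scaleB"
    and rels: "\<And>r. r \<in> R \<Longrightarrow> k_algebra.free_eval scaleB h r = 0"
  obtains f where "k_algebra_hom scaleA scaleB f" "\<And>g. f (gens g) = h g"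
proof -
  interpret B: k_algebra scaleB by fact
  let ?E = "B.free_eval h"
  interpret E: k_algebra_hom free_scale scaleB ?E
    by (rule B.k_algebra_hom_free_eval)
  from A obtain \<pi> where \<pi>: "k_algebra_hom free_scale scaleA \<pi>"
    and gens: "\<And>g. \<pi> (free_gen g) = gens g" and "surj \<pi>"
    and ker: "{f. \<pi> f = 0} = two_sided_ideal hull R"
    by (auto simp: presented_by_def)
  interpret \<pi>: k_algebra_hom free_scale scaleA \<pi> by fact
  have "two_sided_ideal hull R \<subseteq> {f. ?E f = 0}"
    using rels by (intro hull_minimal two_sided_ideal_kernel[OF E.k_algebra_hom_axioms]) auto
  then have E_eq: "?E f = ?E g" if "\<pi> f = \<pi> g" for f g
    using that ker E.hom_diff[of f g] \<pi>.hom_diff[of f g] by auto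
  define F where "F a = ?E (inv_into UNIV \<pi> a)" for a
  have F: "F (\<pi> f) = ?E f" for f
    unfolding F_def by (rule E_eq) (simp add: \<open>surj \<pi>\<close> surj_f_inv_f)
  have "k_algebra_hom scaleA scaleB F"
  proof (rule k_algebra_homI[OF \<pi>.cod.k_algebra_axioms B])
    fix a b c
    obtain f g where fg: "a = \<pi> f" "b = \<pi> g"
      using \<open>surj \<pi>\<close> by (metis surjD)
    show "F (a + b) = F a + F b" "F (a * b) = F a * F b" "F (scaleA c a) = scaleB c (F a)"
      using F[of "f + g"] F[of "f * g"] F[of "free_scale c f"]
      by (simp_all add: fg F \<pi>.hom_simps E.hom_simps)
    show "F 1 = 1"
      using F[of 1] by (simp add: \<pi>.hom_simps E.hom_simps)
  qed
  moreover have "F (gens g) = h g" for g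
    using F[of "free_gen g"] by (simp add: gens B.free_eval_gen)
  ultimately show thesis
    by (rule that)
qed

lemma presented_by_induct [consumes 1, case_names one add scale gen]:
  assumes A: "presented_by scaleA gens R"
    and one: "P 1"
    and add: "\<And>a b. P a \<Longrightarrow> P b \<Longrightarrow> P (a + b)"
    and scale: "\<And>c a. P a \<Longrightarrow> P (scaleA c a)"
    and gen: "\<And>g a. P a \<Longrightarrow> P (gens g * a)"
  shows "P a"
proof -
  from A obtain \<pi> where \<pi>: "k_algebra_hom free_scale scaleA \<pi>"
    and gens: "\<And>g. \<pi> (free_gen g) = gens g" and "surj \<pi>"
    by (auto simp: presented_by_def)
  interpret \<pi>: k_algebra_hom free_scale scaleA \<pi> by fact
  have word: "P (\<pi> (Poly_Mapping.single (Word w) 1))" for w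
  proof (induction w)
    case Nil
    show ?case
      using one by (simp add: \<pi>.hom_one flip: zero_word_def)
  next
    case (Cons g w)
    then show ?case
      by (simp add: single_word_Cons \<pi>.hom_mult gens gen)
  qed
  have "P (\<pi> f)" for f
  proof (induction f rule: free_algebra_induct)
    case zero
    show ?case
      using scale[OF one, of 0] by (simp add: \<pi>.hom_zero)
  next
    case (add f g)
    then show ?case
      by (simp add: \<pi>.hom_add assms(3))
  next
    case (single w c)
    obtain l where "w = Word l" by (cases w)
    then show ?case
      using scale[OF word[of l], of c] by (simp add: free_scale_single flip: \<pi>.hom_scale)
  qed
  then show ?thesis
    using \<open>surj \<pi>\<close> by (metis surjD)
qed

section \<open>Ore localization at normal elements\<close>

lemma ring_inv_eqI:
  assumes "u * v = 1" "v * u = 1"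
  shows "ring_inv u = v"
  unfolding ring_inv_def
proof (rule the_equality)
  fix w assume "u * w = 1 \<and> w * u = 1"
  then show "w = v"
    using assms by (metis mult.assoc mult_1 mult_1_right)
qed (use assms in auto)

lemma ring_unit_inv:
  assumes "ring_unit u"
  shows "u * ring_inv u = 1" "ring_inv u * u = 1"
  using assms ring_inv_eqI unfolding ring_unit_def by metis+

lemma ring_unit_mult_right_cancel:
  assumes "ring_unit u"
  shows "a * u = b * u \<longleftrightarrow> a = b"
  using ring_unit_inv(1)[OF assms] by (metis mult.assoc mult_1_right)

lemma ring_unit_mult:
  assumes "ring_unit u" "ring_unit v"
  shows "ring_unit (u * v)"
proof -
  obtain u' v' where "u * u' = 1" "u' * u = 1" "v * v' = 1" "v' * v = 1"
    using assms by (auto simp: ring_unit_def)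
  then have "u * v * (v' * u') = 1" "v' * u' * (u * v) = 1"
    by (metis mult.assoc mult_1)+
  then show ?thesis
    unfolding ring_unit_def by blast
qed

lemma ring_unit_one: "ring_unit 1"
  unfolding ring_unit_def by (metis mult_1)

lemma ring_unit_power: "ring_unit u \<Longrightarrow> ring_unit (u ^ n)"
  by (induction n) (simp_all add: ring_unit_one ring_unit_mult)

lemma (in k_algebra) ring_unit_scale:
  assumes "c \<noteq> 0" "ring_unit u"
  shows "ring_unit (scale c u)"
proof -
  obtain v where "u * v = 1" "v * u = 1"
    using assms by (auto simp: ring_unit_def)
  with assms(1) show ?thesis
    unfolding ring_unit_def
    by (intro exI[of _ "scale (inverse c) v"]) (simp add: scale_mult_left scale_mult_right)
qed

text \<open>If \<open>a d = d a'\<close> can be solved for \<open>a'\<close> whatever \<open>a\<close> and \<open>d \<in> S\<close> are, denominators can be moved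
  to the left of numerators. The relation "\<open>b = \<iota> a (\<iota> d)\<^sup>-\<^sup>1\<close> and \<open>c = f a (f d)\<^sup>-\<^sup>1\<close> for a common pair
  \<open>(a, d)\<close>" between \<open>b\<close> and \<open>c\<close> is then the graph of a homomorphism.\<close>

lemma ore_localization_extend:
  assumes ore: "is_ore_localization scaleA scaleL S \<iota>"
    and S_mult: "\<And>d e. d \<in> S \<Longrightarrow> e \<in> S \<Longrightarrow> d * e \<in> S" and S_one: "1 \<in> S"
    and normal: "\<And>d a. d \<in> S \<Longrightarrow> \<exists>a'. a * d = d * a'"
    and hom: "k_algebra_hom scaleA scaleB f"
    and units: "\<And>d. d \<in> S \<Longrightarrow> ring_unit (f d)"
  obtains g where "k_algebra_hom scaleL scaleB g" "\<And>a. g (\<iota> a) = f a"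
proof -
  interpret f: k_algebra_hom scaleA scaleB f by fact
  interpret \<iota>: k_algebra_hom scaleA scaleL \<iota>
    using ore by (simp add: is_ore_localization_def)
  have \<iota>_unit: "ring_unit (\<iota> d)" if "d \<in> S" for d
    using ore that by (simp add: is_ore_localization_def)
  have frac: "\<exists>a. \<exists>d\<in>S. b * \<iota> d = \<iota> a" for b
  proof -
    obtain a d where "d \<in> S" "b = \<iota> a * ring_inv (\<iota> d)"
      using ore unfolding is_ore_localization_def by blast
    then show ?thesis
      using ring_unit_inv(2)[OF \<iota>_unit] by (metis mult.assoc mult_1_right)
  qed
  have \<iota>_eq: "f a = f a'" if "\<iota> a = \<iota> a'" for a a'
  proof -
    have "\<iota> (a - a') = 0"
      using that by (simp add: \<iota>.hom_diff)
    then obtain e where "e \<in> S" "(a - a') * e = 0"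
      using ore unfolding is_ore_localization_def by blast
    then have "f a * f e = f a' * f e"
      by (metis eq_iff_diff_eq_0 f.hom_mult left_diff_distrib)
    then show ?thesis
      using units[OF \<open>e \<in> S\<close>] by (simp add: ring_unit_mult_right_cancel)
  qed
  define G where "G b c \<longleftrightarrow> (\<exists>a. \<exists>d\<in>S. b * \<iota> d = \<iota> a \<and> c * f d = f a)" for b c
  have total: "\<exists>c. G b c" for b
  proof -
    obtain a d where "d \<in> S" "b * \<iota> d = \<iota> a"
      using frac by blast
    moreover have "f a * ring_inv (f d) * f d = f a"
      using ring_unit_inv(2)[OF units[OF \<open>d \<in> S\<close>]] by (simp add: mult.assoc)
    ultimately show ?thesis
      unfolding G_def by blast
  qed
  have common: "\<exists>d. d\<in>S \<and> (\<exists>a a'. b * \<iota> d = \<iota> a \<and> c * f d = f a \<and> b' * \<iota> d = \<iota> a' \<and> c' * f d = f a')"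
    if "G b c" "G b' c'" for b c b' c'
  proof -
    obtain a d where d: "d \<in> S" "b * \<iota> d = \<iota> a" "c * f d = f a"
      using \<open>G b c\<close> unfolding G_def by blast
    obtain a' d' where d': "d' \<in> S" "b' * \<iota> d' = \<iota> a'" "c' * f d' = f a'"
      using \<open>G b' c'\<close> unfolding G_def by blast
    obtain d'' where d'': "d * d' = d' * d''"
      using normal[OF d'(1)] by blast
    have "b * \<iota> (d * d') = \<iota> (a * d')" "c * f (d * d') = f (a * d')"
      using d by (simp_all add: \<iota>.hom_mult f.hom_mult flip: mult.assoc)
    moreover have "b' * \<iota> (d * d') = \<iota> (a' * d'')" "c' * f (d * d') = f (a' * d'')"
      unfolding d'' using d' by (simp_all add: \<iota>.hom_mult f.hom_mult flip: mult.assoc)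
    moreover have "d * d' \<in> S"
      using d d' S_mult by blast
    ultimately show ?thesis
      by blast
  qed
  have unique: "c = c'" if G: "G b c" "G b c'" for b c c'
  proof -
    obtain d a a' where "d \<in> S" "b * \<iota> d = \<iota> a" "c * f d = f a" "b * \<iota> d = \<iota> a'" "c' * f d = f a'"
      using common[OF G] by blast
    then have "c * f d = c' * f d"
      using \<iota>_eq[of a a'] by simp
    then show ?thesis
      using units[OF \<open>d \<in> S\<close>] by (simp add: ring_unit_mult_right_cancel)
  qed
  define g where "g b = (THE c. G b c)" for b
  have g: "g b = c \<longleftrightarrow> G b c" for b c
    using total[of b] unique unfolding g_def by (metis theI)
  have G_g: "G b (g b)" for b
    using g by blast
  have "k_algebra_hom scaleL scaleB g"
  proof (rule k_algebra_homI[OF \<iota>.cod.k_algebra_axioms f.cod.k_algebra_axioms])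
    fix b b' r
    obtain d a a' where "d \<in> S" "b * \<iota> d = \<iota> a" "g b * f d = f a" "b' * \<iota> d = \<iota> a'" "g b' * f d = f a'"
      using common[OF G_g G_g, of b b'] by blast
    then have "(b + b') * \<iota> d = \<iota> (a + a')" "(g b + g b') * f d = f (a + a')"
      "scaleL r b * \<iota> d = \<iota> (scaleA r a)" "scaleB r (g b) * f d = f (scaleA r a)"
      by (simp_all add: distrib_right \<iota>.hom_simps f.hom_simps
          \<iota>.cod.scale_mult_left f.cod.scale_mult_left)
    then show "g (b + b') = g b + g b'" "g (scaleL r b) = scaleB r (g b)"
      unfolding g G_def using \<open>d \<in> S\<close> by blast+
    obtain a2 d2 where 2: "d2 \<in> S" "b' * \<iota> d2 = \<iota> a2" "g b' * f d2 = f a2"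
      using G_g[of b'] unfolding G_def by blast
    obtain a1 d1 where 1: "d1 \<in> S" "b * \<iota> d1 = \<iota> a1" "g b * f d1 = f a1"
      using G_g[of b] unfolding G_def by blast
    obtain a3 where a3: "a2 * d1 = d1 * a3"
      using normal[OF 1(1)] by blast
    have "b * b' * \<iota> (d2 * d1) = b * (b' * \<iota> d2) * \<iota> d1"
      by (simp add: \<iota>.hom_mult mult.assoc)
    also have "\<dots> = b * \<iota> (d1 * a3)"
      by (simp add: 2 \<iota>.hom_mult mult.assoc flip: a3)
    also have "\<dots> = \<iota> (a1 * a3)"
      using 1 by (simp add: \<iota>.hom_mult flip: mult.assoc)
    finally have num: "b * b' * \<iota> (d2 * d1) = \<iota> (a1 * a3)" .
    have "g b * g b' * f (d2 * d1) = g b * (g b' * f d2) * f d1"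
      by (simp add: f.hom_mult mult.assoc)
    also have "\<dots> = g b * f (d1 * a3)"
      by (simp add: 2 f.hom_mult mult.assoc flip: a3)
    also have "\<dots> = f (a1 * a3)"
      using 1 by (simp add: f.hom_mult flip: mult.assoc)
    finally show "g (b * b') = g b * g b'"
      using num unfolding g G_def using S_mult[OF 2(1) 1(1)] by blast
  next
    show "g 1 = 1"
      unfolding g G_def using S_one by (intro exI[of _ 1] bexI[of _ 1]) auto
  qed
  moreover have "g (\<iota> a) = f a" for a
    unfolding g G_def using S_one by (intro exI[of _ a] bexI[of _ 1]) (auto simp: \<iota>.hom_one f.hom_one)
  ultimately show thesis
    by (rule that)
qed

section \<open>Gradings by ordered groups\<close>

text \<open>Applying \<open>E i - \<chi> i g'\<close> removes the \<open>g'\<close>-component and multiplies the \<open>g\<close>-component by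
  \<open>\<chi> i g - \<chi> i g'\<close>, which is nonzero for a suitable \<open>i\<close>.\<close>

lemma (in vector_space) simultaneous_eigenvectors_independent:
  fixes E :: "'i \<Rightarrow> 'b \<Rightarrow> 'b" and \<chi> :: "'i \<Rightarrow> 'g \<Rightarrow> 'a"
  assumes "finite F"
    and add: "\<And>i a b. E i (a + b) = E i a + E i b" 
    and scale: "\<And>i c a. E i (scale c a) = scale c (E i a)"
    and eigen: "\<And>i g. g \<in> F \<Longrightarrow> E i (h g) = scale (\<chi> i g) (h g)"
    and sep: "\<And>g g'. g \<in> F \<Longrightarrow> g' \<in> F \<Longrightarrow> g \<noteq> g' \<Longrightarrow> \<exists>i. \<chi> i g \<noteq> \<chi> i g'"
    and "sum h F = 0" "g \<in> F"
  shows "h g = 0"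
  using assms(1,4-7)
proof (induction F arbitrary: h g rule: finite_induct)
  case (insert g' F)
  have zero: "E i 0 = 0" for i
    using add[of i 0 0] by simp
  have E_sum: "E i (sum h G) = (\<Sum>g\<in>G. E i (h g))" for i G and h :: "'g \<Rightarrow> 'b"
    by (induction G rule: infinite_finite_induct) (simp_all add: zero add)
  have F: "h g = 0" if "g \<in> F" for g
  proof -
    obtain i where i: "\<chi> i g \<noteq> \<chi> i g'"
      using insert.prems(2)[of g g'] \<open>g \<in> F\<close> insert.hyps(2) by blast
    define k where "k f = scale (\<chi> i f - \<chi> i g') (h f)" for f
    have "(\<Sum>f\<in>insert g' F. k f) = E i (sum h (insert g' F)) - scale (\<chi> i g') (sum h (insert g' F))"
      unfolding E_sum scale_sum_right sum_subtractf[symmetric] k_def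
      by (rule sum.cong) (simp_all only: insert.prems(1) scale_left_diff_distrib)
    also have "\<dots> = 0"
      using insert.prems(3) by (simp only: zero scale_zero_right diff_self)
    finally have sum0: "sum k F = 0"
      using insert.hyps by (simp add: k_def)
    have "k g = 0"
    proof (rule insert.IH[OF _ _ sum0 \<open>g \<in> F\<close>])
      show "E l (k f) = scale (\<chi> l f) (k f)" if "f \<in> F" for l f
        using insert.prems(1)[of f l] that by (simp add: k_def scale mult.commute)
      show "\<exists>l. \<chi> l f \<noteq> \<chi> l f'" if "f \<in> F" "f' \<in> F" "f \<noteq> f'" for f f'
        using insert.prems(2)[OF insertI2 insertI2 that(3)] that by simp
    qed
    with i show ?thesis
      by (simp add: k_def)
  qed
  with insert.prems(3) insert.hyps have "h g' = 0"
    by simp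
  with F insert.prems(4) show ?case
    by auto
qed simp

text \<open>The family \<open>H\<close> is arbitrary, because spanning is established for explicit monomials before
  they are known to exhaust the homogeneous components.\<close>

definition graded_sums :: "('g \<Rightarrow> 'r::ring_1 set) \<Rightarrow> 'r set" where
  "graded_sums H = {sum h F | h F. finite F \<and> (\<forall>g\<in>F. h g \<in> H g)}"

lemma graded_sumsE:
  assumes "b \<in> graded_sums H"
  obtains h F where "finite F" "\<And>g. g \<in> F \<Longrightarrow> h g \<in> H g" "b = sum h F"
proof -
  obtain h F where "finite F" "\<forall>g\<in>F. h g \<in> H g" "b = sum h F"
    using assms unfolding graded_sums_def by blast
  then show thesis
    by (intro that[of F h]) simp_all
qed

lemma graded_sums_mono: "(\<And>g. H g \<subseteq> K g) \<Longrightarrow> graded_sums H \<subseteq> graded_sums K"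
  unfolding graded_sums_def by blast

lemma graded_sums_incl: "a \<in> H g \<Longrightarrow> a \<in> graded_sums H"
  unfolding graded_sums_def by (intro CollectI exI[of _ "\<lambda>_. a"] exI[of _ "{g}"]) simp

lemma graded_sums_add:
  assumes zero: "\<And>g. 0 \<in> H g" and add: "\<And>g a b. a \<in> H g \<Longrightarrow> b \<in> H g \<Longrightarrow> a + b \<in> H g"
    and a: "a \<in> graded_sums H" and b: "b \<in> graded_sums H"
  shows "a + b \<in> graded_sums H"
proof -
  obtain h F where h: "finite F" "\<And>g. g \<in> F \<Longrightarrow> h g \<in> H g" "a = sum h F"
    using a by (rule graded_sumsE) (rule that; assumption)
  obtain k G where k: "finite G" "\<And>g. g \<in> G \<Longrightarrow> k g \<in> H g" "b = sum k G"
    using b by (rule graded_sumsE) (rule that; assumption)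
  let ?h = "\<lambda>g. if g \<in> F then h g else 0" and ?k = "\<lambda>g. if g \<in> G then k g else 0"
  have "sum h F = sum ?h (F \<union> G)" "sum k G = sum ?k (F \<union> G)"
    using h(1) k(1) by (intro sum.mono_neutral_cong_left; simp)+
  then have "a + b = (\<Sum>g\<in>F \<union> G. ?h g + ?k g)"
    unfolding h(3) k(3) sum.distrib by simp
  moreover have "\<forall>g\<in>F \<union> G. ?h g + ?k g \<in> H g"
    using h(2) k(2) by (auto intro: add zero)
  ultimately show ?thesis
    unfolding graded_sums_def using h(1) k(1)
    by (intro CollectI exI[of _ "\<lambda>g. ?h g + ?k g"] exI[of _ "F \<union> G"]) simp
qed

lemma graded_sums_sum:
  assumes "\<And>g. 0 \<in> H g" "\<And>g a b. a \<in> H g \<Longrightarrow> b \<in> H g \<Longrightarrow> a + b \<in> H g"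
    and "\<And>g. g \<in> F \<Longrightarrow> h g \<in> graded_sums H"
  shows "sum h F \<in> graded_sums H"
  using assms(3)
  by (induction F rule: infinite_finite_induct)
     (auto intro: graded_sums_add assms(1,2) graded_sums_incl)

text \<open>The lexicographic order makes \<open>\<int>\<^sup>3\<close> an ordered group.\<close>

instance prod :: (linordered_ab_group_add, linordered_ab_group_add) linordered_ab_group_add
proof
  fix a b c :: "'a \<times> 'b"
  assume "a \<le> b"
  then show "c + a \<le> c + b"
    by (cases a; cases b; cases c) auto
qed

lemma add_extremal:
  fixes a b c d :: "'g::linordered_ab_group_add"
  assumes "a + b = c + d" "a \<le> c" "b \<le> d"
  shows "a = c \<and> b = d"
proof -
  have "\<not> a < c"
  proof
    assume "a < c"
    from add_less_le_mono[OF this assms(3)] assms(1) show False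
      by simp
  qed
  then have "a = c"
    using assms(2) by (simp add: order.order_iff_strict)
  with assms(1) show ?thesis
    by simp
qed

locale graded_ring =
  fixes H :: "'g::linordered_ab_group_add \<Rightarrow> 'r::ring_1 set"
  assumes H_zero: "0 \<in> H g"
    and H_add: "a \<in> H g \<Longrightarrow> b \<in> H g \<Longrightarrow> a + b \<in> H g"
    and H_uminus: "a \<in> H g \<Longrightarrow> - a \<in> H g"
    and H_one: "1 \<in> H 0"
    and H_mult: "a \<in> H g \<Longrightarrow> b \<in> H g' \<Longrightarrow> a * b \<in> H (g + g')"
    and H_independent: "finite F \<Longrightarrow> (\<And>g. g \<in> F \<Longrightarrow> h g \<in> H g) \<Longrightarrow> sum h F = 0 \<Longrightarrow>
      g \<in> F \<Longrightarrow> h g = 0"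
    and H_spans: "b \<in> graded_sums H"
begin

lemma H_sum: "(\<And>i. i \<in> I \<Longrightarrow> f i \<in> H g) \<Longrightarrow> sum f I \<in> H g"
  by (induction I rule: infinite_finite_induct) (auto intro: H_zero H_add)

lemma H_diff: "a \<in> H g \<Longrightarrow> b \<in> H g \<Longrightarrow> a - b \<in> H g"
  using H_add[of a g "- b"] H_uminus[of b g] by simp

lemma homogeneous_eq_component:
  assumes "finite F" "\<And>g. g \<in> F \<Longrightarrow> h g \<in> H g" "sum h F \<in> H g"
  shows "sum h F = (if g \<in> F then h g else 0)"
proof -
  define k where "k f = (if f \<in> F then h f else 0) - (if f = g then sum h F else 0)" for f
  have "sum k (insert g F) = 0"
  proof -
    have "(\<Sum>f\<in>insert g F. if f \<in> F then h f else 0) = sum h F"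
      using assms(1) by (auto intro!: sum.mono_neutral_cong_right)
    then show ?thesis
      unfolding k_def sum_subtractf using assms(1) by (simp add: sum.delta)
  qed
  moreover have "k f \<in> H f" for f
    using assms(2,3) unfolding k_def by (intro H_diff) (simp_all add: H_zero)
  ultimately have "k g = 0"
    using assms(1) by (intro H_independent[of "insert g F" k]) simp_all
  then show ?thesis
    by (simp add: k_def split: if_splits)
qed

text \<open>Components are unique, so a homogeneous element that is a sum of elements of the smaller family
  \<open>M\<close> equals one of the summands, or is \<open>0\<close>.\<close>

lemma graded_eq_if_subfamily_spans:
  assumes "\<And>g. M g \<subseteq> H g" "\<And>g. 0 \<in> M g" "\<And>b. b \<in> graded_sums M"
  shows "H g = M g"
proof
  show "H g \<subseteq> M g"
  proof
    fix a assume "a \<in> H g"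
    obtain h F where h: "finite F" "\<And>g. g \<in> F \<Longrightarrow> h g \<in> M g" "a = sum h F"
      using assms(3) by (rule graded_sumsE) (rule that; assumption)
    then have "a = (if g \<in> F then h g else 0)"
      using homogeneous_eq_component[of F h g] assms(1) \<open>a \<in> H g\<close> by blast
    then show "a \<in> M g"
      using h(2) assms(2) by auto
  qed
qed (rule assms(1))

lemma graded_decomposition_nonzero:
  assumes "b \<noteq> 0"
  obtains h F where "finite F" "F \<noteq> {}" "\<And>g. g \<in> F \<Longrightarrow> h g \<in> H g \<and> h g \<noteq> 0" "b = sum h F"
proof -
  obtain h F where h: "finite F" "\<And>g. g \<in> F \<Longrightarrow> h g \<in> H g" "b = sum h F"
    using H_spans by (rule graded_sumsE) (rule that; assumption)
  let ?F = "{g \<in> F. h g \<noteq> 0}"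
  have "b = sum h ?F"
    unfolding h(3) using h(1) by (intro sum.mono_neutral_right) auto
  moreover from this assms have "?F \<noteq> {}"
    by fastforce
  ultimately show thesis
    using h by (intro that[of ?F h]) auto
qed

text \<open>If \<open>f + g\<close> is reached by only one pair of degrees, the corresponding component of the product
  is a single product of homogeneous elements and does not cancel.\<close>

lemma unique_sum_degree_zero:
  assumes fin: "finite F" "finite G"
    and h: "\<And>g. g \<in> F \<Longrightarrow> h g \<in> H g" and k: "\<And>g. g \<in> G \<Longrightarrow> k g \<in> H g"
    and prod1: "sum h F * sum k G = 1"
    and fg: "f \<in> F" "g \<in> G" "h f * k g \<noteq> 0"
    and unique: "\<And>f' g'. f' \<in> F \<Longrightarrow> g' \<in> G \<Longrightarrow> f' + g' = f + g \<Longrightarrow> f' = f \<and> g' = g"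
  shows "f + g = 0"
proof -
  let ?E = "(\<lambda>(f, g). f + g) ` (F \<times> G)"
  define c where "c e = (\<Sum>(f, g) | (f, g) \<in> F \<times> G \<and> f + g = e. h f * k g)" for e
  have c_H: "c e \<in> H e" for e
    unfolding c_def using h k by (intro H_sum) (auto intro: H_mult)
  have "(\<Sum>e\<in>?E. c e) = (\<Sum>(f, g)\<in>F \<times> G. h f * k g)"
    unfolding c_def using fin
    by (subst sum.group[symmetric, of "F \<times> G" ?E "\<lambda>(f, g). f + g"])
       (auto intro!: sum.cong simp: case_prod_beta)
  also have "\<dots> = 1"
    using prod1 by (simp add: sum_product sum.cartesian_product)
  finally have "sum c ?E = 1" .
  have "sum c ?E = (if 0 \<in> ?E then c 0 else 0)"
    using fin c_H H_one \<open>sum c ?E = 1\<close> by (intro homogeneous_eq_component) simp_all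
  then have one: "0 \<in> ?E" "c 0 = 1"
    using \<open>sum c ?E = 1\<close> by (auto split: if_splits)
  have "{(f', g'). (f', g') \<in> F \<times> G \<and> f' + g' = f + g} = {(f, g)}"
    using fg unique by auto
  then have "c (f + g) = h f * k g"
    unfolding c_def by simp
  show "f + g = 0"
  proof (rule ccontr)
    assume "f + g \<noteq> 0"
    have "sum c (?E - {0}) = 0"
      using \<open>sum c ?E = 1\<close> one fin by (simp add: sum_diff1)
    then have "c (f + g) = 0"
      using fin fg \<open>f + g \<noteq> 0\<close> c_H by (intro H_independent[of "?E - {0}" c]) auto
    with \<open>c (f + g) = h f * k g\<close> fg(3) show False
      by simp
  qed
qed

text \<open>The largest degrees in the supports of a unit and of its inverse add up to \<open>0\<close>, and so do the
  smallest ones.\<close>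

lemma units_homogeneous:
  assumes no_zero_divisors:
      "\<And>a b g g'. a \<in> H g \<Longrightarrow> b \<in> H g' \<Longrightarrow> a \<noteq> 0 \<Longrightarrow> b \<noteq> 0 \<Longrightarrow> a * b \<noteq> 0"
    and "u * v = 1"
  shows "\<exists>g. u \<in> H g \<and> v \<in> H (- g)"
proof -
  have "u \<noteq> 0" "v \<noteq> 0"
    using assms(2) by auto
  obtain h F where F: "finite F" "F \<noteq> {}" "\<And>g. g \<in> F \<Longrightarrow> h g \<in> H g \<and> h g \<noteq> 0" "u = sum h F"
    using \<open>u \<noteq> 0\<close> by (rule graded_decomposition_nonzero) (rule that; assumption)
  obtain k G where G: "finite G" "G \<noteq> {}" "\<And>g. g \<in> G \<Longrightarrow> k g \<in> H g \<and> k g \<noteq> 0" "v = sum k G"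
    using \<open>v \<noteq> 0\<close> by (rule graded_decomposition_nonzero) (rule that; assumption)
  have prod1: "sum h F * sum k G = 1"
    using assms(2) F G by simp
  have mem: "Max F \<in> F" "Max G \<in> G" "Min F \<in> F" "Min G \<in> G"
    using F G by auto
  have nonzero: "h f * k g \<noteq> 0" if "f \<in> F" "g \<in> G" for f g
    using F(3)[OF that(1)] G(3)[OF that(2)] by (intro no_zero_divisors) auto
  have top: "Max F + Max G = 0"
  proof (rule unique_sum_degree_zero[OF F(1) G(1) _ _ prod1])
    fix f g assume "f \<in> F" "g \<in> G" "f + g = Max F + Max G"
    moreover from this have "f \<le> Max F" "g \<le> Max G"
      using F(1) G(1) by simp_all
    ultimately show "f = Max F \<and> g = Max G"
      using add_extremal[of f g "Max F" "Max G"] by blast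
  qed (use F(3) G(3) mem nonzero in auto)
  have bot: "Min F + Min G = 0"
  proof (rule unique_sum_degree_zero[OF F(1) G(1) _ _ prod1])
    fix f g assume "f \<in> F" "g \<in> G" "f + g = Min F + Min G"
    moreover from this have "Min F \<le> f" "Min G \<le> g"
      using F(1) G(1) by simp_all
    ultimately show "f = Min F \<and> g = Min G"
      using add_extremal[of "Min F" "Min G" f g] by auto
  qed (use F(3) G(3) mem nonzero in auto)
  have le: "Min F \<le> Max F" "Min G \<le> Max G"
    using F(1,2) G(1,2) by simp_all
  have eq: "Min F = Max F" "Min G = Max G"
  proof -
    have "\<not> Min F < Max F"
    proof
      assume "Min F < Max F"
      from add_less_le_mono[OF this le(2)] top bot show False
        by simp
    qed
    then show "Min F = Max F"
      using le(1) by (simp add: order.order_iff_strict)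
    with top bot have "Max F + Min G = Max F + Max G"
      by simp
    then show "Min G = Max G"
      by simp
  qed
  have single: "S = {Max S}" if "finite S" "S \<noteq> {}" "Min S = Max S" for S :: "'g set"
  proof -
    have "f = Max S" if "f \<in> S" for f
      using Min_le[OF \<open>finite S\<close> that] Max_ge[OF \<open>finite S\<close> that] \<open>Min S = Max S\<close>
      by simp
    then show ?thesis
      using Max_in[OF \<open>finite S\<close> \<open>S \<noteq> {}\<close>] by blast
  qed
  have "sum h F = sum h {Max F}" "sum k G = sum k {Max G}"
    using single F(1,2) G(1,2) eq by metis+
  then have "u = h (Max F)" "v = k (Max G)"
    using F(4) G(4) by simp_all
  moreover have "Max G = - Max F"
    using top by (simp add: eq_neg_iff_add_eq_0 add.commute)
  ultimately show ?thesis
    using F(3) G(3) mem by metis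
qed

end

section \<open>Commutation up to scalars and polynomials in one element\<close>

text \<open>The integer power \<open>a\<^sup>n\<close> when \<open>b\<close> is the inverse of \<open>a\<close>. It is also used with \<open>a = x\<close> and \<open>b = y\<close>,
  which are not inverse to each other; then it picks a generator for each degree in \<open>x\<close>.\<close>

definition ipow :: "'a::ring_1 \<Rightarrow> 'a \<Rightarrow> int \<Rightarrow> 'a" where
  "ipow a b n = (if 0 \<le> n then a ^ nat n else b ^ nat (- n))"

lemma ipow_0 [simp]: "ipow a b 0 = 1"
  by (simp add: ipow_def)

lemma ipow_of_nat [simp]: "ipow a b (int n) = a ^ n"
  by (simp add: ipow_def)

lemma ipow_minus_of_nat [simp]: "ipow a b (- int n) = b ^ n"
  by (simp add: ipow_def)

lemma ipow_swap: "ipow b a n = ipow a b (- n)"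
  by (cases n rule: int_cases2) simp_all

lemma mult_ipow:
  assumes "a * b = 1"
  shows "a * ipow a b n = ipow a b (n + 1)"
proof (cases n rule: int_cases3)
  case (pos k)
  then show ?thesis
    by (simp add: ipow_def nat_add_distrib)
next
  case (neg k)
  then obtain j where k: "k = Suc j"
    by (cases k) auto
  have "a * b ^ k = b ^ j"
    using assms by (simp add: k flip: mult.assoc)
  moreover have "n + 1 = - int j"
    by (simp add: neg k)
  ultimately show ?thesis
    by (simp only: neg ipow_minus_of_nat)
qed (simp add: ipow_def)

lemma mult_ipow_minus:
  assumes "b * a = 1"
  shows "b * ipow a b n = ipow a b (n - 1)"
  using mult_ipow[OF assms, of "- n"] by (simp add: ipow_swap[of b a])

lemma ipow_unit:
  assumes "a * b = 1" "b * a = 1"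
  shows "ring_unit (ipow a b n)"
proof -
  have "ring_unit a" "ring_unit b"
    using assms unfolding ring_unit_def by blast+
  then show ?thesis
    by (simp add: ipow_def ring_unit_power)
qed

lemma ipow_mult_power: "ipow a b (i * int m) = ipow a b i ^ m"
proof (cases i rule: int_cases2)
  case (nonneg k)
  then show ?thesis
    by (simp only: ipow_of_nat power_mult flip: of_nat_mult)
next
  case (nonpos k)
  then have "i * int m = - int (k * m)"
    by simp
  then show ?thesis
    by (simp only: nonpos ipow_minus_of_nat power_mult)
qed

lemma ipow_mult_ipow_minus:
  assumes "a * b = 1" "b * a = 1"
  shows "ipow a b i * ipow a b (- i) = 1"
  using assms by (cases i rule: int_cases2) (simp_all add: left_right_inverse_power)

lemma ipow_commute:
  assumes "c * a = a * c" "c * b = b * c"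
  shows "c * ipow a b n = ipow a b n * c"
  using assms by (simp add: ipow_def power_commuting_commutes)

context k_algebra
begin

lemma skew_commute_mult:
  assumes "a * b = scale c (b * a)" "a * b' = scale c' (b' * a)"
  shows "a * (b * b') = scale (c * c') (b * b' * a)"
proof -
  have "a * (b * b') = scale c (b * (a * b'))"
    by (simp add: assms(1) scale_mult_left flip: mult.assoc)
  then show ?thesis
    by (simp add: assms(2) scale_mult_right mult.assoc)
qed

lemma skew_commute_power:
  assumes "a * b = scale c (b * a)"
  shows "a * b ^ n = scale (c ^ n) (b ^ n * a)"
  by (induction n) (simp_all add: skew_commute_mult[OF assms])

lemma skew_commute_inverse:
  assumes "a * b = scale c (b * a)" "b * b' = 1" "b' * b = 1" "c \<noteq> 0"
  shows "a * b' = scale (inverse c) (b' * a)"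
proof -
  have "b' * (a * b) * b' = scale c (b' * b * a * b')"
    by (simp add: assms(1) scale_mult_left scale_mult_right mult.assoc)
  moreover have "b' * (a * b) * b' = b' * a"
    using assms(2) by (simp add: mult.assoc)
  ultimately show ?thesis
    using assms(3,4) by simp
qed

lemma skew_commute_sym:
  assumes "a * b = scale c (b * a)" "c \<noteq> 0"
  shows "b * a = scale (inverse c) (a * b)"
  using assms by simp

lemma skew_commute_ipow:
  assumes "a * b = scale c (b * a)" "b * b' = 1" "b' * b = 1" "c \<noteq> 0"
  shows "a * ipow b b' n = scale (c powi n) (ipow b b' n * a)"
  using skew_commute_power[OF assms(1)] skew_commute_power[OF skew_commute_inverse[OF assms]]
  by (simp add: ipow_def power_int_def)

definition poly_eval :: "'a \<Rightarrow> 'k poly \<Rightarrow> 'a" where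
  "poly_eval a f = fold_coeffs (\<lambda>c b. scale c 1 + a * b) f 0"

lemma poly_eval_0 [simp]: "poly_eval a 0 = 0"
  by (simp add: poly_eval_def)

lemma poly_eval_pCons [simp]: "poly_eval a (pCons c f) = scale c 1 + a * poly_eval a f"
  by (cases "c = 0 \<and> f = 0") (auto simp: poly_eval_def)

lemma poly_eval_1 [simp]: "poly_eval a 1 = 1"
  by (simp add: one_pCons)

lemma poly_eval_add: "poly_eval a (f + g) = poly_eval a f + poly_eval a g"
  by (induction f g rule: poly_induct2) (simp_all add: scale_left_distrib algebra_simps)

lemma poly_eval_smult: "poly_eval a (smult c f) = scale c (poly_eval a f)"
  by (induction f) (simp_all add: scale_right_distrib scale_mult_right)

lemma poly_eval_mult: "poly_eval a (f * g) = poly_eval a f * poly_eval a g"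
  by (induction f)
     (simp_all add: poly_eval_add poly_eval_smult scale_mult_left algebra_simps)

lemma poly_eval_diff: "poly_eval a (f - g) = poly_eval a f - poly_eval a g"
  using poly_eval_add[of a "f - g" g] by simp

lemma poly_eval_monom: "poly_eval a (monom c n) = scale c (a ^ n)"
  by (induction n) (simp_all add: monom_0 monom_Suc scale_mult_right)

lemma skew_commute_poly_eval:
  assumes "b * a = scale c (a * b)"
  shows "b * poly_eval a f = poly_eval a (pcompose f [:0, c:]) * b"
proof (induction f)
  case (pCons d f)
  have "b * (a * poly_eval a f) = scale c (a * (b * poly_eval a f))"
    by (simp add: assms scale_mult_left mult.assoc flip: mult.assoc[of b a])
  then show ?case
    by (simp add: pcompose_pCons pCons poly_eval_add poly_eval_smult distrib_left distrib_right
        scale_mult_left scale_mult_right mult.assoc)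
qed simp

lemma commute_poly_eval:
  assumes "b * a = a * b"
  shows "b * poly_eval a f = poly_eval a f * b"
  using skew_commute_poly_eval[of b a 1] assms by (simp add: pcompose_idR)

end

lemma powi_eq_powi_iff:
  fixes p :: "'k::field"
  assumes "p \<noteq> 0" "\<And>n::nat. n > 0 \<Longrightarrow> p ^ n \<noteq> 1"
  shows "p powi m = p powi n \<longleftrightarrow> m = n"
proof
  have *: "k \<le> l" if "p powi k = p powi l" for k l
  proof (rule ccontr)
    assume "\<not> k \<le> l"
    have "p powi (k - l) = 1"
      using that assms(1) by (simp add: power_int_diff)
    moreover have "p powi (k - l) = p ^ nat (k - l)"
      using \<open>\<not> k \<le> l\<close> by (simp add: power_int_def)
    ultimately show False
      using assms(2)[of "nat (k - l)"] \<open>\<not> k \<le> l\<close> by simp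
  qed
  show "m = n" if "p powi m = p powi n"
    using *[OF that] *[OF that[symmetric]] by simp
qed simp

lemma divisor_of_monom:
  fixes f g :: "'k::field poly"
  assumes "f * g = monom c n" "c \<noteq> 0"
  shows "\<exists>d m. d \<noteq> 0 \<and> f = monom d m"
  using assms
proof (induction n arbitrary: f g)
  case 0
  then have "degree (f * g) = 0" "f \<noteq> 0" "g \<noteq> 0"
    by (auto simp: monom_0)
  then have "degree f = 0"
    by (simp add: degree_mult_eq)
  then obtain d where "f = [:d:]"
    by (rule degree_eq_zeroE)
  with \<open>f \<noteq> 0\<close> show ?case
    by (intro exI[of _ d] exI[of _ 0]) (auto simp: monom_0)
next
  case (Suc n)
  obtain a f' where f: "f = pCons a f'" by (cases f)
  obtain b g' where g: "g = pCons b g'" by (cases g)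
  have "coeff (f * g) 0 = 0"
    by (simp add: Suc.prems)
  then have "a = 0 \<or> b = 0"
    by (auto simp: f g coeff_mult)
  then show ?case
  proof
    assume "a = 0"
    then have "pCons 0 (f' * g) = pCons 0 (monom c n)"
      using Suc.prems(1) by (simp add: f monom_Suc)
    then have "\<exists>d m. d \<noteq> 0 \<and> f' = monom d m"
      using Suc.IH[of f' g] Suc.prems(2) by simp
    with \<open>a = 0\<close> show ?thesis
      unfolding f by (metis monom_Suc)
  next
    assume "b = 0"
    then have "pCons 0 (f * g') = pCons 0 (monom c n)"
      using Suc.prems(1) by (simp add: g monom_Suc)
    then show ?thesis
      using Suc.IH[of f g'] Suc.prems(2) by simp
  qed
qed

section \<open>The localized algebra\<close>

locale weyl_algebra = k_algebra scale
  for scale :: "'k::field \<Rightarrow> 'l::ring_1 \<Rightarrow> 'l" +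
  fixes p q :: 'k and x y z s t :: 'l
  assumes p_nonzero: "p \<noteq> 0" and q_nonzero: "q \<noteq> 0"
    and xy: "x * y = scale p (y * x) + 1"
    and z_eq: "z = x * y - y * x"
    and st: "s * t = scale q (t * s)"
    and sx: "s * x = x * s" and sy: "s * y = y * s"
    and tx: "t * x = x * t" and ty: "t * y = y * t"
begin

lemma z_yx: "z = scale (p - 1) (y * x) + 1"
  by (simp add: z_eq xy scale_left_diff_distrib)

lemma scale_p: "scale (p - 1) a + (a + b) = scale p a + b"
  by (simp add: scale_left_diff_distrib)

lemma xz: "x * z = scale p (z * x)"
proof -
  have "x * z = scale (p - 1) (x * y * x) + x"
    by (simp add: z_yx distrib_left scale_mult_right mult.assoc)
  also have "x * y * x = scale p (y * x * x) + x"
    by (simp add: xy distrib_right scale_mult_left)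
  also have "scale (p - 1) (scale p (y * x * x) + x) + x = scale p (z * x)"
    using scale_p[of x 0]
    by (simp add: z_yx distrib_right scale_mult_left scale_right_distrib mult.commute[of p] add.assoc)
  finally show ?thesis .
qed

lemma yz: "y * z = scale (inverse p) (z * y)"
proof (rule skew_commute_sym[OF _ p_nonzero])
  have "z * y = scale (p - 1) (y * (x * y)) + y"
    by (simp add: z_yx distrib_right scale_mult_left mult.assoc)
  also have "\<dots> = scale p (y * z)"
    using scale_p[of y 0]
    by (simp add: xy z_yx distrib_left scale_mult_right scale_right_distrib mult.commute[of p] add.assoc)
  finally show "z * y = scale p (y * z)" .
qed

lemma sz: "s * z = z * s"
  using skew_commute_mult[of s x 1 y 1] skew_commute_mult[of s y 1 x 1] sx sy
  by (simp add: z_eq right_diff_distrib left_diff_distrib)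

lemma tz: "t * z = z * t"
  using skew_commute_mult[of t x 1 y 1] skew_commute_mult[of t y 1 x 1] tx ty
  by (simp add: z_eq right_diff_distrib left_diff_distrib)

lemma ts: "t * s = scale (inverse q) (s * t)"
  by (rule skew_commute_sym[OF st q_nonzero])

end

text \<open>The assumption \<open>generated\<close> says that the localization is spanned by the products of
  \<open>x\<close>, \<open>y\<close>, \<open>s\<close>, \<open>t\<close> and the inverses of \<open>z\<close>, \<open>s\<close>, \<open>t\<close>; it is phrased as an induction rule that builds
  these products from the right.\<close>

locale localized_weyl_algebra = weyl_algebra scale p q x y z s t
  for scale :: "'k::field \<Rightarrow> 'l::ring_1 \<Rightarrow> 'l" and p q x y z s t +
  fixes z' s' t' :: 'l
  assumes p_no_root: "\<And>n::nat. n > 0 \<Longrightarrow> p ^ n \<noteq> 1"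
    and q_no_root: "\<And>n::nat. n > 0 \<Longrightarrow> q ^ n \<noteq> 1"
    and zz': "z * z' = 1" "z' * z = 1"
    and ss': "s * s' = 1" "s' * s = 1"
    and tt': "t * t' = 1" "t' * t = 1"
    and generated [case_names one add scale x y s t z' s' t']:
      "P 1 \<Longrightarrow> (\<And>a b. P a \<Longrightarrow> P b \<Longrightarrow> P (a + b)) \<Longrightarrow> (\<And>c a. P a \<Longrightarrow> P (scale c a)) \<Longrightarrow>
       (\<And>a. P a \<Longrightarrow> P (x * a)) \<Longrightarrow> (\<And>a. P a \<Longrightarrow> P (y * a)) \<Longrightarrow>
       (\<And>a. P a \<Longrightarrow> P (s * a)) \<Longrightarrow> (\<And>a. P a \<Longrightarrow> P (t * a)) \<Longrightarrow>
       (\<And>a. P a \<Longrightarrow> P (z' * a)) \<Longrightarrow> (\<And>a. P a \<Longrightarrow> P (s' * a)) \<Longrightarrow>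
       (\<And>a. P a \<Longrightarrow> P (t' * a)) \<Longrightarrow> P b"
begin

lemma p_minus_1: "p - 1 \<noteq> 0"
  using p_no_root[of 1] by simp

lemma commute_inverse: "a * b = b * a \<Longrightarrow> b * b' = 1 \<Longrightarrow> b' * b = 1 \<Longrightarrow> a * b' = b' * a" for a b b' :: 'l
  using skew_commute_inverse[of a b 1 b'] by simp

lemma xz': "x * z' = scale (inverse p) (z' * x)"
  by (rule skew_commute_inverse[OF xz zz' p_nonzero])

lemma yz': "y * z' = scale p (z' * y)"
  using skew_commute_inverse[OF yz zz'] p_nonzero by simp

lemmas s_z' = commute_inverse[OF sz zz'] and t_z' = commute_inverse[OF tz zz']
lemmas x_s' = commute_inverse[OF sx[symmetric] ss'] and y_s' = commute_inverse[OF sy[symmetric] ss']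
  and z_s' = commute_inverse[OF sz[symmetric] ss'] and z'_s' = commute_inverse[OF s_z'[symmetric] ss']
lemmas x_t' = commute_inverse[OF tx[symmetric] tt'] and y_t' = commute_inverse[OF ty[symmetric] tt']
  and z_t' = commute_inverse[OF tz[symmetric] tt'] and z'_t' = commute_inverse[OF t_z'[symmetric] tt']

lemma st': "s * t' = scale (inverse q) (t' * s)"
  by (rule skew_commute_inverse[OF st tt' q_nonzero])

lemma ts': "t * s' = scale q (s' * t)"
  using skew_commute_inverse[OF ts ss'] q_nonzero by simp

lemma t's: "t' * s = scale q (s * t')"
  using skew_commute_sym[OF st'] q_nonzero by simp

abbreviation ev :: "'k poly \<Rightarrow> 'l" where "ev \<equiv> poly_eval z"

lemma ev_yx: "ev [:- 1, 1:] = scale (p - 1) (y * x)"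
  by (simp add: z_yx)

lemma ev_xy: "ev [:- 1, p:] = scale (p - 1) (x * y)"
  by (simp add: z_yx xy scale_right_distrib scale_mult_right distrib_right scale_left_diff_distrib
      algebra_simps)

lemma ev_x_shift: "x * ev f = ev (pcompose f [:0, p:]) * x"
  by (rule skew_commute_poly_eval[OF xz])

lemma ev_y_shift: "y * ev f = ev (pcompose f [:0, inverse p:]) * y"
  by (rule skew_commute_poly_eval[OF yz])

section \<open>Transcendence of $z$\<close>

text \<open>A nonzero polynomial \<open>f\<close> of least degree that annihilates \<open>z\<close> would divide every other one, in
  particular \<open>f(z/p) (z - 1)\<close> (from \<open>y f(z) x = 0\<close>) and \<open>f(p z) (p z - 1)\<close> (from \<open>x f(z) y = 0\<close>).
  Comparing leading and constant coefficients, the former forces \<open>f(1) = 0\<close>. The latter shows that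
  \<open>f(p\<^sup>n) = 0\<close> implies \<open>f(p\<^sup>n\<^sup>+\<^sup>1) = 0\<close>, so that \<open>f\<close> has infinitely many roots. Thus
  the relations and \<open>1 \<noteq> 0\<close> force \<open>z\<close> to be transcendental.\<close>

lemma ev_eq_0_iff: "ev f = 0 \<longleftrightarrow> f = 0"
proof
  assume "ev f = 0"
  show "f = 0"
  proof (rule ccontr)
    assume "f \<noteq> 0"
    obtain m where m: "m \<noteq> 0" "ev m = 0"
      and least: "\<And>g. g \<noteq> 0 \<Longrightarrow> ev g = 0 \<Longrightarrow> degree m \<le> degree g"
      using ex_has_least_nat[of "\<lambda>f. f \<noteq> 0 \<and> ev f = 0" f degree] \<open>f \<noteq> 0\<close> \<open>ev f = 0\<close> by auto
    have dvd: "m dvd g" if "ev g = 0" for g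
    proof -
      have "g mod m = g - g div m * m"
        by (simp add: minus_div_mult_eq_mod)
      then have "ev (g mod m) = 0"
        by (simp add: poly_eval_diff poly_eval_mult that m(2))
      then show ?thesis
        using degree_mod_less'[OF m(1), of g] least[of "g mod m"]
        unfolding dvd_eq_mod_eq_0 \<open>ev (g mod m) = 0\<close> by (metis not_le)
    qed
    have const: "poly m 0 \<noteq> 0"
    proof
      assume "poly m 0 = 0"
      then obtain g where g: "m = pCons 0 g"
        by (cases m) auto
      then have "z' * (z * ev g) = 0"
        using m(2) by simp
      then have "ev g = 0"
        by (simp add: zz' flip: mult.assoc)
      then show False
        using least[of g] m(1) g by auto
    qed
    have deg: "degree m \<noteq> 0"
    proof
      assume "degree m = 0"
      then obtain c where "m = [:c:]"
        by (rule degree_eq_zeroE)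
      then show False
        using m by simp
    qed
    let ?d = "pcompose m [:0, inverse p:]" and ?u = "pcompose m [:0, p:]"
    have "ev (?d * [:- 1, 1:]) = scale (p - 1) (y * ev m * x)"
      by (simp only: poly_eval_mult ev_yx ev_y_shift scale_mult_right mult.assoc)
    then have "m dvd ?d * [:- 1, 1:]"
      by (intro dvd) (simp add: m(2))
    then obtain h where h: "?d * [:- 1, 1:] = m * h" ..
    have "ev (?u * [:- 1, p:]) = scale (p - 1) (x * ev m * y)"
      by (simp only: poly_eval_mult ev_xy ev_x_shift scale_mult_right mult.assoc)
    then have "m dvd ?u * [:- 1, p:]"
      by (intro dvd) (simp add: m(2))
    then obtain k where k: "?u * [:- 1, p:] = m * k" ..
    have "poly m 1 = 0"
    proof (rule ccontr)
      assume "poly m 1 \<noteq> 0"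
      have "poly (?d * [:- 1, 1:]) 1 = 0"
        by simp
      then have "poly h 1 = 0"
        using \<open>poly m 1 \<noteq> 0\<close> by (simp only: h poly_mult mult_eq_0_iff simp_thms)
      then obtain h' where "h = [:- 1, 1:] * h'"
        by (auto simp: poly_eq_0_iff_dvd)
      then have "?d * [:- 1, 1:] = m * h' * [:- 1, 1:]"
        unfolding h by (simp only: mult_ac)
      then have d: "?d = m * h'"
        by (rule mult_right_cancel[THEN iffD1, rotated]) simp
      have deg_d: "degree ?d = degree m"
        using p_nonzero by (simp add: degree_pcompose)
      have "h' \<noteq> 0"
        using d m(1) deg_d deg by auto
      then have "degree h' = 0"
        using deg_d m(1) unfolding d by (simp add: degree_mult_eq)
      then obtain c where c: "h' = [:c:]"
        by (rule degree_eq_zeroE)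
      have "poly ?d 0 = poly m 0"
        by (simp add: poly_pcompose)
      then have "c = 1"
        using const by (simp add: d c)
      then have "?d = m"
        by (simp add: d c)
      moreover have "lead_coeff ?d = lead_coeff m * inverse p ^ degree m"
        using p_nonzero by (subst lead_coeff_comp) simp_all
      ultimately have "inverse p ^ degree m = 1"
        using m(1) by simp
      then show False
        using p_no_root[of "degree m"] deg by (simp add: power_inverse)
    qed
    have roots: "poly m (p ^ n) = 0" for n
    proof (induction n)
      case (Suc n)
      have "poly (?u * [:- 1, p:]) (p ^ n) = 0"
        by (simp only: k poly_mult Suc mult_zero_left)
      then have "poly m (p ^ Suc n) * (p ^ Suc n - 1) = 0"
        by (auto simp: poly_pcompose mult.commute)
      then show ?case
        using p_no_root[of "Suc n"] by auto
    qed (simp add: \<open>poly m 1 = 0\<close>)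
    have "inj (\<lambda>n::nat. p ^ n)"
    proof (rule injI)
      fix i j :: nat
      assume "p ^ i = p ^ j"
      then show "i = j"
        using powi_eq_powi_iff[OF p_nonzero p_no_root, of "int i" "int j"] by simp
    qed
    then have "infinite (range (\<lambda>n::nat. p ^ n))"
      by (simp add: finite_image_iff)
    moreover have "range (\<lambda>n::nat. p ^ n) \<subseteq> {a. poly m a = 0}"
      using roots by auto
    ultimately show False
      using poly_roots_finite[OF m(1)] finite_subset by blast
  qed
qed simp

lemma ev_inject: "ev f = ev g \<longleftrightarrow> f = g"
  using ev_eq_0_iff[of "f - g"] by (simp add: poly_eval_diff)


section \<open>The grading of the localized algebra\<close>

text \<open>Nonzero Laurent polynomials in \<open>z\<close>. Leaving out \<open>0\<close> makes them a multiplicatively closed set, so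
  that "a nonzero multiple of" is stable under composition in the computations below.\<close>

definition laurent :: "'l set" where
  "laurent = {z' ^ m * ev f | m f. f \<noteq> 0}"

lemma laurentI: "f \<noteq> 0 \<Longrightarrow> z' ^ m * ev f \<in> laurent"
  unfolding laurent_def by blast

lemma laurent_ev: "f \<noteq> 0 \<Longrightarrow> ev f \<in> laurent"
  using laurentI[of f 0] by simp

lemma laurent_one: "1 \<in> laurent"
  using laurent_ev[of 1] by simp

lemma ev_commute_z': "ev f * z' = z' * ev f"
  by (rule commute_poly_eval[symmetric]) (simp add: zz')

lemma z'_power_cancel: "z ^ n * (z' ^ n * a) = a"
proof (induction n arbitrary: a)
  case (Suc n)
  have "z ^ Suc n * (z' ^ Suc n * a) = z ^ n * ((z * z') * (z' ^ n * a))"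
    by (simp only: power_Suc2[of z] power_Suc[of z'] mult.assoc)
  then show ?case
    by (simp add: zz' Suc)
qed simp

lemma laurent_nonzero: "r \<in> laurent \<Longrightarrow> r \<noteq> 0"
proof
  assume "r \<in> laurent" "r = 0"
  then obtain m f where "f \<noteq> 0" "z' ^ m * ev f = 0"
    by (auto simp: laurent_def)
  then show False
    using z'_power_cancel[of m "ev f"] by (simp add: ev_eq_0_iff)
qed

lemma laurent_mult: "r \<in> laurent \<Longrightarrow> r' \<in> laurent \<Longrightarrow> r * r' \<in> laurent"
proof -
  assume "r \<in> laurent" "r' \<in> laurent"
  then obtain m f n g where r: "f \<noteq> 0" "g \<noteq> 0" "r = z' ^ m * ev f" "r' = z' ^ n * ev g"
    by (auto simp: laurent_def)
  have "ev f * z' ^ n = z' ^ n * ev f"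
    by (rule power_commuting_commutes[symmetric]) (rule ev_commute_z'[symmetric])
  have "r * r' = z' ^ m * (ev f * z' ^ n) * ev g"
    unfolding r(3,4) by (simp only: mult.assoc)
  also have "\<dots> = z' ^ (m + n) * ev (f * g)"
    unfolding \<open>ev f * z' ^ n = z' ^ n * ev f\<close> by (simp only: mult.assoc poly_eval_mult power_add)
  finally have "r * r' = z' ^ (m + n) * ev (f * g)" .
  then show ?thesis
    using r(1,2) by (simp add: laurentI)
qed

lemma laurent_scale: "c \<noteq> 0 \<Longrightarrow> r \<in> laurent \<Longrightarrow> scale c r \<in> laurent"
  using laurent_mult[OF laurent_ev[of "[:c:]"]] by (simp add: scale_one_mult)

lemma laurent_z': "z' \<in> laurent"
  using laurentI[of 1 1] by simp

lemma laurent_add: "r \<in> insert 0 laurent \<Longrightarrow> r' \<in> insert 0 laurent \<Longrightarrow> r + r' \<in> insert 0 laurent"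
proof -
  assume "r \<in> insert 0 laurent" "r' \<in> insert 0 laurent"
  moreover have "\<exists>m f. r = z' ^ m * ev f" if "r \<in> insert 0 laurent" for r
  proof (cases "r = 0")
    case True
    then have "r = z' ^ 0 * ev 0" by simp
    then show ?thesis by blast
  next
    case False
    then show ?thesis
      using that by (auto simp: laurent_def)
  qed
  ultimately obtain m f n g where r: "r = z' ^ m * ev f" "r' = z' ^ n * ev g"
    by presburger
  \<comment> \<open>Both summands are brought to the denominator \<open>z\<^sup>m\<^sup>+\<^sup>n\<close>.\<close>
  have *: "z' ^ m * a = z' ^ (m + n) * (z ^ n * a)" for m n a
  proof -
    have "z' ^ n * z ^ n = z ^ n * z' ^ n"
      by (intro power_commuting_commutes power_commuting_commutes[symmetric]) (simp add: zz')
    then have "z' ^ n * (z ^ n * a) = z ^ n * (z' ^ n * a)"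
      by (simp only: mult.assoc[symmetric])
    then have "z' ^ n * (z ^ n * a) = a"
      by (simp add: z'_power_cancel)
    then show ?thesis
      by (simp add: power_add mult.assoc)
  qed
  have "r + r' = z' ^ (m + n) * ev (monom 1 n * f + monom 1 m * g)"
    using *[of m "ev f" n] *[of n "ev g" m] unfolding r
    by (simp add: poly_eval_add poly_eval_mult poly_eval_monom add.commute distrib_left)
  then show ?thesis
    by (cases "monom 1 n * f + monom 1 m * g = 0") (auto intro: laurentI)
qed

definition moves_past_laurent :: "'l \<Rightarrow> bool" where
  "moves_past_laurent a \<longleftrightarrow> (\<forall>r\<in>laurent. \<exists>r'\<in>laurent. a * r = r' * a)"

lemma moves_past_laurent_skew:
  assumes "a * z = scale c (z * a)" "c \<noteq> 0"
  shows "moves_past_laurent a"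
  unfolding moves_past_laurent_def
proof
  fix r assume "r \<in> laurent"
  then obtain m f where r: "f \<noteq> 0" "r = z' ^ m * ev f"
    by (auto simp: laurent_def)
  have "a * z' ^ m = scale (inverse c ^ m) (z' ^ m * a)"
    by (intro skew_commute_power skew_commute_inverse[OF assms(1) zz' assms(2)])
  moreover have "a * ev f = ev (pcompose f [:0, c:]) * a"
    by (rule skew_commute_poly_eval[OF assms(1)])
  moreover have "a * r = a * z' ^ m * ev f"
    by (simp only: r mult.assoc)
  ultimately have "a * r = scale (inverse c ^ m) (z' ^ m * ev (pcompose f [:0, c:])) * a"
    by (simp add: scale_mult_left mult.assoc)
  moreover have "pcompose f [:0, c:] \<noteq> 0"
    using r(1) assms(2) by (simp add: pcompose_eq_0_iff)
  ultimately show "\<exists>r'\<in>laurent. a * r = r' * a"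
    using assms(2) by (auto intro!: bexI laurent_scale laurentI)
qed

lemma moves_past_laurent_mult:
  assumes "moves_past_laurent a" "moves_past_laurent b"
  shows "moves_past_laurent (a * b)"
  using assms unfolding moves_past_laurent_def by (metis mult.assoc)

lemma moves_past_laurent_power:
  assumes "moves_past_laurent a"
  shows "moves_past_laurent (a ^ n)"
proof (induction n)
  case 0
  show ?case by (simp add: moves_past_laurent_def)
qed (simp add: moves_past_laurent_mult assms)

text \<open>\<open>X n\<close> is \<open>x\<^sup>n\<close> or \<open>y\<^sup>-\<^sup>n\<close>. Since \<open>x y\<close> and \<open>y x\<close> are polynomials of degree \<open>1\<close> in \<open>z\<close>, the products of
  these elements are those of the powers of one element up to nonzero Laurent polynomials.\<close>

abbreviation X :: "int \<Rightarrow> 'l" where "X \<equiv> ipow x y"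

lemma moves_past_x: "moves_past_laurent x"
  by (rule moves_past_laurent_skew[OF xz p_nonzero])

lemma moves_past_y: "moves_past_laurent y"
  by (rule moves_past_laurent_skew[OF yz]) (simp add: p_nonzero)

lemma moves_past_X: "moves_past_laurent (X n)"
  by (simp add: ipow_def moves_past_laurent_power moves_past_x moves_past_y)

lemma xy_laurent: "x * y \<in> laurent"
proof -
  have "x * y = scale (inverse (p - 1)) (ev [:- 1, p:])"
    using p_minus_1 by (simp only: ev_xy scale_scale) simp
  then show ?thesis
    using p_minus_1 p_nonzero laurent_scale[OF _ laurent_ev[of "[:- 1, p:]"]] by auto
qed

lemma yx_laurent: "y * x \<in> laurent"
proof -
  have "y * x = scale (inverse (p - 1)) (ev [:- 1, 1:])"
    using p_minus_1 by (simp only: ev_yx scale_scale) simp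
  then show ?thesis
    using p_minus_1 laurent_scale[OF _ laurent_ev[of "[:- 1, 1:]"]] by auto
qed

lemma x_mult_X: "\<exists>r\<in>laurent. x * X n = r * X (n + 1)"
proof (cases "0 \<le> n")
  case True
  then have "x * X n = 1 * X (n + 1)"
    by (simp add: ipow_def nat_add_distrib)
  then show ?thesis
    using laurent_one by blast
next
  case False
  then obtain k where n: "n = - int (Suc k)"
    by (cases n) auto
  then have "n + 1 = - int k"
    by simp
  then have "X n = y ^ Suc k" "X (n + 1) = y ^ k"
    by (simp_all only: n ipow_minus_of_nat)
  then have "x * X n = x * y * X (n + 1)"
    by (simp add: mult.assoc)
  then show ?thesis
    using xy_laurent by blast
qed

lemma y_mult_X: "\<exists>r\<in>laurent. y * X n = r * X (n - 1)"
proof (cases "0 < n")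
  case True
  then obtain k where n: "n = int (Suc k)"
    by (cases n rule: int_cases3) (auto dest!: gr0_implies_Suc)
  then have "n - 1 = int k"
    by simp
  then have "X n = x ^ Suc k" "X (n - 1) = x ^ k"
    by (simp_all only: n ipow_of_nat)
  then have "y * X n = y * x * X (n - 1)"
    by (simp add: mult.assoc)
  then show ?thesis
    using yx_laurent by blast
next
  case False
  then obtain k where n: "n = - int k"
    by (cases n rule: int_cases3) auto
  then have "n - 1 = - int (Suc k)"
    by simp
  then have "X n = y ^ k" "X (n - 1) = y ^ Suc k"
    by (simp_all only: n ipow_minus_of_nat)
  then have "y * X n = 1 * X (n - 1)"
    by simp
  then show ?thesis
    using laurent_one by blast
qed

lemma X_mult_X: "\<exists>r\<in>laurent. X m * X n = r * X (m + n)"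
proof -
  have step: "\<exists>r\<in>laurent. a * b * X n = r * X k"
    if b: "\<exists>r\<in>laurent. b * X n = r * X l" and a: "moves_past_laurent a"
      and aX: "\<exists>r\<in>laurent. a * X l = r * X k"
    for a b k l
  proof -
    obtain r where r: "r \<in> laurent" "b * X n = r * X l"
      using b by blast
    obtain r' where r': "r' \<in> laurent" "a * r = r' * a"
      using a r(1) unfolding moves_past_laurent_def by blast
    obtain r'' where r'': "r'' \<in> laurent" "a * X l = r'' * X k"
      using aX by blast
    have "a * b * X n = a * r * X l"
      by (simp only: r(2) mult.assoc)
    also have "\<dots> = r' * (a * X l)"
      by (simp only: r'(2) mult.assoc)
    also have "\<dots> = r' * r'' * X k"
      by (simp only: r''(2) mult.assoc)
    finally have "a * b * X n = r' * r'' * X k" .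
    then show ?thesis
      using laurent_mult[OF r'(1) r''(1)] by blast
  qed
  have base: "\<exists>r\<in>laurent. 1 * X n = r * X n"
    using laurent_one by blast
  have "\<exists>r\<in>laurent. x ^ k * X n = r * X (int k + n)" for k
  proof (induction k)
    case (Suc k)
    show ?case
      using step[OF Suc.IH moves_past_x x_mult_X] by (simp add: algebra_simps)
  qed (use base in simp)
  moreover have "\<exists>r\<in>laurent. y ^ k * X n = r * X (- int k + n)" for k
  proof (induction k)
    case (Suc k)
    show ?case
      using step[OF Suc.IH moves_past_y y_mult_X] by (simp add: algebra_simps)
  qed (use base in simp)
  ultimately show ?thesis
    by (cases m rule: int_cases2) auto
qed

text \<open>Multiplication by \<open>X (- n)\<close> turns \<open>r * X n\<close> into a nonzero Laurent polynomial.\<close>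

lemma laurent_mult_X_nonzero: "r \<in> laurent \<Longrightarrow> r * X n \<noteq> 0"
proof
  assume r: "r \<in> laurent" "r * X n = 0"
  obtain r' where r': "r' \<in> laurent" "X n * X (- n) = r' * X (n + - n)"
    using X_mult_X by blast
  then have "r * r' = r * X n * X (- n)"
    by (simp add: mult.assoc)
  then show False
    using laurent_nonzero[OF laurent_mult[OF r(1) r'(1)]] r(2) by simp
qed

text \<open>The degree records the eigenvalues under conjugation by \<open>z\<close>, \<open>t\<close> and \<open>s\<close>: it counts \<open>x\<close>
  (negatively \<open>y\<close>), \<open>s\<close> and \<open>t\<close>.\<close>

type_synonym tridegree = "int \<times> int \<times> int"

fun homogeneous :: "tridegree \<Rightarrow> 'l set" where
  "homogeneous (n, j, k) = {a. a * z = scale (p powi n) (z * a) \<and>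
     a * t = scale (q powi j) (t * a) \<and> s * a = scale (q powi k) (a * s)}"

lemma homogeneous_zero: "0 \<in> homogeneous g"
  by (cases g rule: homogeneous.cases) simp

lemma homogeneous_add: "a \<in> homogeneous g \<Longrightarrow> b \<in> homogeneous g \<Longrightarrow> a + b \<in> homogeneous g"
  by (cases g rule: homogeneous.cases) (simp add: distrib_left distrib_right scale_right_distrib)

lemma homogeneous_uminus: "a \<in> homogeneous g \<Longrightarrow> - a \<in> homogeneous g"
  by (cases g rule: homogeneous.cases) simp

lemma homogeneous_one: "1 \<in> homogeneous 0"
  by (simp add: zero_prod_def)

lemma homogeneous_mult:
  assumes "a \<in> homogeneous g" "b \<in> homogeneous g'"
  shows "a * b \<in> homogeneous (g + g')"
proof -
  obtain n j k where g: "g = (n, j, k)" by (cases g)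
  obtain n' j' k' where g': "g' = (n', j', k')" by (cases g')
  have right: "a * b * c = scale (d * d') (c * (a * b))"
    if "a * c = scale d (c * a)" "b * c = scale d' (c * b)" for c d d'
  proof -
    have "a * b * c = scale d' (a * c * b)"
      by (simp add: that(2) scale_mult_right mult.assoc)
    then show ?thesis
      by (simp add: that(1) scale_mult_left mult.commute[of d] mult.assoc)
  qed
  show ?thesis
    using assms right[of z] right[of t] skew_commute_mult[of s a _ b]
    by (simp add: g g' power_int_add p_nonzero q_nonzero)
qed

lemma homogeneous_x: "x \<in> homogeneous (1, 0, 0)"
  by (simp add: xz sx tx)

lemma homogeneous_y: "y \<in> homogeneous (- 1, 0, 0)"
  by (simp add: yz sy ty power_int_minus)

lemma homogeneous_s: "s \<in> homogeneous (0, 1, 0)"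
  by (simp add: sz st)

lemma homogeneous_t: "t \<in> homogeneous (0, 0, 1)"
  by (simp add: tz st)

lemma homogeneous_s': "s' \<in> homogeneous (0, - 1, 0)"
  by (simp add: z_s' ts' ss' power_int_minus q_nonzero)

lemma homogeneous_t': "t' \<in> homogeneous (0, 0, - 1)"
  by (simp add: z_t' st' tt' power_int_minus)

lemma homogeneous_z': "z' \<in> homogeneous 0"
  by (simp add: zero_prod_def s_z' t_z' zz')

lemma homogeneous_ev: "ev f \<in> homogeneous 0"
  using commute_poly_eval[of z z f] commute_poly_eval[of t z f] commute_poly_eval[of s z f]
  by (simp add: zero_prod_def sz tz)

lemma homogeneous_power:
  assumes "a \<in> homogeneous (n, j, k)"
  shows "a ^ m \<in> homogeneous (int m * n, int m * j, int m * k)"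
proof (induction m)
  case 0
  show ?case
    using homogeneous_one by (simp add: zero_prod_def)
next
  case (Suc m)
  show ?case
    using homogeneous_mult[OF assms Suc.IH] by (simp add: algebra_simps)
qed

lemma homogeneous_ipow:
  assumes "a \<in> homogeneous (n, j, k)" "b \<in> homogeneous (- n, - j, - k)"
  shows "ipow a b m \<in> homogeneous (m * n, m * j, m * k)"
  using homogeneous_power[OF assms(1), of "nat m"] homogeneous_power[OF assms(2), of "nat (- m)"]
  by (simp add: ipow_def)

lemma homogeneous_laurent: "r \<in> insert 0 laurent \<Longrightarrow> r \<in> homogeneous 0"
proof -
  have "z' ^ m \<in> homogeneous 0" for m
    using homogeneous_power[of z' 0 0 0 m] homogeneous_z' by (simp add: zero_prod_def)
  then have "z' ^ m * ev f \<in> homogeneous 0" for m f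
    using homogeneous_mult[OF _ homogeneous_ev] by (metis add_0)
  then show "r \<in> insert 0 laurent \<Longrightarrow> r \<in> homogeneous 0"
    using homogeneous_zero unfolding laurent_def by blast
qed

abbreviation ST :: "int \<Rightarrow> int \<Rightarrow> 'l" where "ST j k \<equiv> ipow s s' j * ipow t t' k"

fun monomials :: "tridegree \<Rightarrow> 'l set" where
  "monomials (n, j, k) = (\<lambda>r. r * X n * ST j k) ` insert 0 laurent"

lemma monomialsI: "r \<in> insert 0 laurent \<Longrightarrow> r * X n * ST j k \<in> monomials (n, j, k)"
  by (simp only: monomials.simps) blast

lemma monomials_homogeneous: "monomials g \<subseteq> homogeneous g"
proof -
  obtain n j k where g: "g = (n, j, k)" by (cases g)
  have "X n \<in> homogeneous (n, 0, 0)" "ipow s s' j \<in> homogeneous (0, j, 0)"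
    "ipow t t' k \<in> homogeneous (0, 0, k)"
    using homogeneous_ipow[of x 1 0 0 y n] homogeneous_ipow[of s 0 1 0 s' j]
      homogeneous_ipow[of t 0 0 1 t' k]
      homogeneous_x homogeneous_y homogeneous_s homogeneous_s' homogeneous_t homogeneous_t'
    by (simp_all del: homogeneous.simps)
  then have "r * X n * ST j k \<in> homogeneous (0 + (n, 0, 0) + ((0, j, 0) + (0, 0, k)))"
    if "r \<in> insert 0 laurent" for r
    using homogeneous_laurent[OF that] by (intro homogeneous_mult)
  then show ?thesis
    using homogeneous_zero by (auto simp: g zero_prod_def simp del: homogeneous.simps)
qed

lemma monomials_zero: "0 \<in> monomials g"
  using monomialsI[of 0] by (cases g) auto

lemma monomials_add: "a \<in> monomials g \<Longrightarrow> b \<in> monomials g \<Longrightarrow> a + b \<in> monomials g"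
proof -
  assume ab: "a \<in> monomials g" "b \<in> monomials g"
  obtain n j k where g: "g = (n, j, k)" by (cases g)
  obtain r r' where "r \<in> insert 0 laurent" "r' \<in> insert 0 laurent"
    "a = r * X n * ST j k" "b = r' * X n * ST j k"
    using ab unfolding g monomials.simps by blast
  then show ?thesis
    using monomialsI[OF laurent_add, of r r' n j k] by (simp add: g distrib_right)
qed

text \<open>Left multiplication by a generator maps monomials to monomials, so the monomials span.\<close>

lemma monomials_span: "b \<in> graded_sums monomials"
proof -
  have incl: "a \<in> graded_sums monomials" if "a \<in> monomials g" for a g
    using that by (rule graded_sums_incl)
  have sum_closed: "sum f F \<in> graded_sums monomials" if "\<And>g. g \<in> F \<Longrightarrow> f g \<in> graded_sums monomials"
    for f :: "tridegree \<Rightarrow> 'l" and F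
    using monomials_zero monomials_add that by (rule graded_sums_sum)
  have left: "w * a \<in> graded_sums monomials"
    if w: "\<And>r n j k. r \<in> laurent \<Longrightarrow> \<exists>r'\<in>laurent. \<exists>n' j' k'. w * (r * X n * ST j k) = r' * X n' * ST j' k'"
      and a: "a \<in> graded_sums monomials" for w a
  proof -
    have "w * b \<in> graded_sums monomials" if b: "b \<in> monomials (n, j, k)" for b n j k
    proof -
      obtain r where r: "r \<in> insert 0 laurent" "b = r * X n * ST j k"
        using b unfolding monomials.simps by blast
      show ?thesis
      proof (cases "r = 0")
        case True
        then show ?thesis
          using r incl[OF monomials_zero] by simp
      next
        case False
        with r obtain r' n' j' k' where "r' \<in> laurent" "w * b = r' * X n' * ST j' k'"
          using w[of r n j k] by auto
        then show ?thesis
          using incl[OF monomialsI[of r' n' j' k']] by simp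
      qed
    qed
    then have w_mono: "w * b \<in> graded_sums monomials" if "b \<in> monomials g" for b g
      using that by (cases g) blast
    obtain h F where h: "\<And>g. g \<in> F \<Longrightarrow> h g \<in> monomials g" "a = sum h F"
      using a by (rule graded_sumsE) (rule that; assumption)
    show ?thesis
      unfolding h(2) sum_distrib_left by (rule sum_closed) (rule w_mono[OF h(1)])
  qed
  have left_skew: "\<exists>r'\<in>laurent. \<exists>n' j' k'. w * (r * X n * ST j k) = r' * X n' * ST j' k'"
    if r: "r \<in> laurent" and w: "moves_past_laurent w"
      and wX: "\<exists>r'\<in>laurent. \<exists>n' j' k'. w * (X n * ST j k) = r' * X n' * ST j' k'"
    for w r n j k
  proof -
    obtain r1 where r1: "r1 \<in> laurent" "w * r = r1 * w"
      using r w unfolding moves_past_laurent_def by blast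
    obtain r2 n' j' k' where r2: "r2 \<in> laurent" "w * (X n * ST j k) = r2 * X n' * ST j' k'"
      using wX by blast
    have "w * (r * X n * ST j k) = (w * r) * (X n * ST j k)"
      by (simp add: mult.assoc)
    also have "\<dots> = r1 * (w * (X n * ST j k))"
      by (simp add: r1(2) mult.assoc)
    also have "\<dots> = r1 * r2 * X n' * ST j' k'"
      by (simp only: r2(2) mult.assoc)
    finally show ?thesis
      using laurent_mult[OF r1(1) r2(1)] by blast
  qed
  have left_st: "\<exists>r'\<in>laurent. \<exists>n' j' k'. w * (X n * ST j k) = r' * X n' * ST j' k'"
    if wX: "w * x = x * w" "w * y = y * w" and wST: "w * ST j k = scale c (ST j' k')" "c \<noteq> 0"
    for w n j k c j' k'
  proof -
    have "w * X n = X n * w"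
      by (rule ipow_commute[OF wX])
    then have "w * (X n * ST j k) = X n * (w * ST j k)"
      by (simp flip: mult.assoc)
    also have "\<dots> = scale c 1 * X n * ST j' k'"
      by (simp add: wST(1) scale_mult_left scale_mult_right)
    finally show ?thesis
      using laurent_scale[OF wST(2) laurent_one] by blast
  qed
  have s_ST: "s * ST j k = scale 1 (ST (j + 1) k)" for j k
    by (simp add: mult_ipow[OF ss'(1)] flip: mult.assoc)
  have s'_ST: "s' * ST j k = scale 1 (ST (j - 1) k)" for j k
    by (simp add: mult_ipow_minus[OF ss'(2)] flip: mult.assoc)
  have t_ST: "t * ST j k = scale (inverse q powi j) (ST j (k + 1))" for j k
  proof -
    have "t * ipow s s' j = scale (inverse q powi j) (ipow s s' j * t)"
      by (rule skew_commute_ipow[OF ts ss']) (simp add: q_nonzero)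
    then have "t * ST j k = scale (inverse q powi j) (ipow s s' j * (t * ipow t t' k))"
      by (simp only: mult.assoc[symmetric] scale_mult_left)
    then show ?thesis
      by (simp only: mult_ipow[OF tt'(1)])
  qed
  have t'_ST: "t' * ST j k = scale (q powi j) (ST j (k - 1))" for j k
  proof -
    have "t' * ipow s s' j = scale (q powi j) (ipow s s' j * t')"
      by (rule skew_commute_ipow[OF t's ss' q_nonzero])
    then have "t' * ST j k = scale (q powi j) (ipow s s' j * (t' * ipow t t' k))"
      by (simp only: mult.assoc[symmetric] scale_mult_left)
    then show ?thesis
      by (simp only: mult_ipow_minus[OF tt'(2)])
  qed
  have commutes: "moves_past_laurent w" if "w * z = z * w" for w
    by (rule moves_past_laurent_skew[of w 1]) (simp_all add: that)
  show ?thesis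
  proof (induction b rule: generated)
    case one
    show ?case
      using incl[OF monomialsI[of 1 0 0 0]] laurent_one by simp
  next
    case (add a b)
    with monomials_zero monomials_add show ?case
      by (rule graded_sums_add)
  next
    case (scale c a)
    show ?case
    proof (cases "c = 0")
      case True
      then show ?thesis
        using incl[OF monomials_zero] by simp
    next
      case False
      have "scale c 1 * a \<in> graded_sums monomials"
      proof (rule left[OF _ scale])
        fix r n j k assume "r \<in> laurent"
        moreover have "scale c 1 * (r * X n * ST j k) = scale c r * X n * ST j k"
          by (simp add: scale_mult_left)
        ultimately show "\<exists>r'\<in>laurent. \<exists>n' j' k'.
            scale c 1 * (r * X n * ST j k) = r' * X n' * ST j' k'"
          using laurent_scale[OF False] by blast
      qed
      then show ?thesis
        by (simp add: scale_one_mult)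
    qed
  next
    case (x a)
    show ?case
    proof (rule left[OF left_skew[OF _ moves_past_x] x])
      fix n j k
      obtain r where r: "r \<in> laurent" "x * X n = r * X (n + 1)"
        using x_mult_X by blast
      have "x * (X n * ST j k) = r * X (n + 1) * ST j k"
        by (simp only: r(2) flip: mult.assoc)
      then show "\<exists>r'\<in>laurent. \<exists>n' j' k'. x * (X n * ST j k) = r' * X n' * ST j' k'"
        using r(1) by blast
    qed
  next
    case (y a)
    show ?case
    proof (rule left[OF left_skew[OF _ moves_past_y] y])
      fix n j k
      obtain r where r: "r \<in> laurent" "y * X n = r * X (n - 1)"
        using y_mult_X by blast
      have "y * (X n * ST j k) = r * X (n - 1) * ST j k"
        by (simp only: r(2) flip: mult.assoc)
      then show "\<exists>r'\<in>laurent. \<exists>n' j' k'. y * (X n * ST j k) = r' * X n' * ST j' k'"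
        using r(1) by blast
    qed
  next
    case (s a)
    show ?case
      by (rule left[OF left_skew[OF _ commutes[OF sz] left_st[OF sx sy s_ST]] s]) simp_all
  next
    case (t a)
    show ?case
      by (rule left[OF left_skew[OF _ commutes[OF tz] left_st[OF tx ty t_ST]] t])
         (simp_all add: q_nonzero)
  next
    case (z' a)
    show ?case
    proof (rule left[OF _ z'])
      fix r n j k assume "r \<in> laurent"
      moreover have "z' * (r * X n * ST j k) = z' * r * X n * ST j k"
        by (simp only: mult.assoc)
      ultimately show "\<exists>r'\<in>laurent. \<exists>n' j' k'.
          z' * (r * X n * ST j k) = r' * X n' * ST j' k'"
        using laurent_mult[OF laurent_z'] by blast
    qed
  next
    case (s' a)
    show ?case
      by (rule left[OF left_skew[OF _ commutes[OF z_s'[symmetric]]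
          left_st[OF x_s'[symmetric] y_s'[symmetric] s'_ST]] s']) simp_all
  next
    case (t' a)
    show ?case
      by (rule left[OF left_skew[OF _ commutes[OF z_t'[symmetric]]
          left_st[OF x_t'[symmetric] y_t'[symmetric] t'_ST]] t']) (simp_all add: q_nonzero)
  qed
qed

lemma homogeneous_independent:
  assumes "finite F" "\<And>g. g \<in> F \<Longrightarrow> h g \<in> homogeneous g" "sum h F = 0" "g \<in> F"
  shows "h g = 0"
proof -
  \<comment> \<open>Conjugation by \<open>z\<close>, \<open>t\<close> and \<open>s\<close> for the indices \<open>0\<close>, \<open>1\<close> and \<open>2\<close>.\<close>
  define E :: "nat \<Rightarrow> 'l \<Rightarrow> 'l" where
    "E i a = (if i = 0 then z' * a * z else if i = 1 then t' * a * t else s * a * s')" for i a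
  define \<chi> :: "nat \<Rightarrow> tridegree \<Rightarrow> 'k" where
    "\<chi> i g = (case g of (n, j, k) \<Rightarrow> if i = 0 then p powi n else if i = 1 then q powi j else q powi k)"
    for i g
  show ?thesis
  proof (rule simultaneous_eigenvectors_independent[where E = E and \<chi> = \<chi>, OF assms(1) _ _ _ _ assms(3,4)])
    show "E i (a + b) = E i a + E i b" for i a b
      by (simp add: E_def distrib_left distrib_right)
    show "E i (scale c a) = scale c (E i a)" for i c a
      by (simp add: E_def scale_mult_left scale_mult_right)
    show "E i (h g) = scale (\<chi> i g) (h g)" if "g \<in> F" for i g
    proof -
      obtain n j k where g: "g = (n, j, k)" by (cases g)
      have "h g * z = scale (p powi n) (z * h g)" "h g * t = scale (q powi j) (t * h g)"
        "s * h g = scale (q powi k) (h g * s)"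
        using assms(2)[OF that] by (simp_all add: g)
      moreover have "z' * (z * a) = a" "t' * (t * a) = a" for a
        by (simp_all add: zz' tt' flip: mult.assoc)
      moreover have "h g * s * s' = h g"
        by (simp add: ss' mult.assoc)
      moreover have "z' * h g * z = z' * (h g * z)" "t' * h g * t = t' * (h g * t)"
        by (simp_all only: mult.assoc)
      ultimately show ?thesis
        by (simp add: E_def \<chi>_def g scale_mult_left scale_mult_right)
    qed
    show "\<exists>i. \<chi> i g \<noteq> \<chi> i g'" if "g \<noteq> g'" for g g'
    proof -
      obtain n j k where g: "g = (n, j, k)" by (cases g)
      obtain n' j' k' where g': "g' = (n', j', k')" by (cases g')
      show ?thesis
      proof (rule ccontr)
        assume "\<nexists>i. \<chi> i g \<noteq> \<chi> i g'"
        then have "\<chi> i g = \<chi> i g'" for i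
          by blast
        from this[of 0] this[of 1] this[of 2]
        have "n = n'" "j = j'" "k = k'"
          by (simp_all add: \<chi>_def g g' powi_eq_powi_iff[OF p_nonzero p_no_root]
              powi_eq_powi_iff[OF q_nonzero q_no_root])
        with that show False
          by (simp add: g g')
      qed
    qed
  qed
qed

sublocale graded_ring homogeneous
proof
  show "b \<in> graded_sums homogeneous" for b
    using graded_sums_mono[of monomials homogeneous, OF monomials_homogeneous] monomials_span by blast
qed (fact homogeneous_zero homogeneous_add homogeneous_uminus homogeneous_one homogeneous_mult
    homogeneous_independent)+

lemma homogeneous_eq_monomials: "homogeneous g = monomials g"
  using monomials_homogeneous monomials_zero monomials_span
  by (rule graded_eq_if_subfamily_spans)

lemma homogeneous_nonzeroE:
  assumes "a \<in> homogeneous (n, j, k)" "a \<noteq> 0"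
  obtains r where "r \<in> laurent" "a = r * X n * ST j k"
  using assms unfolding homogeneous_eq_monomials by auto

text \<open>The factors are \<open>r x\<^sup>n\<close> and \<open>r' x\<^sup>n\<^sup>'\<close> up to units \<open>s\<^sup>j t\<^sup>k\<close> that commute with \<open>x\<close>, \<open>y\<close> and \<open>z\<close>, so their
  product is a nonzero Laurent multiple of \<open>x\<^sup>n\<^sup>+\<^sup>n\<^sup>'\<close> up to units (with powers of \<open>y\<close> for negative
  exponents).\<close>

lemma homogeneous_no_zero_divisors:
  assumes a: "a \<in> homogeneous g" "a \<noteq> 0" and b: "b \<in> homogeneous g'" "b \<noteq> 0"
  shows "a * b \<noteq> 0"
proof
  assume "a * b = 0"
  obtain n j k where g: "g = (n, j, k)" by (cases g)
  obtain n' j' k' where g': "g' = (n', j', k')" by (cases g')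
  obtain r where r: "r \<in> laurent" "a = r * X n * ST j k"
    using a unfolding g by (rule homogeneous_nonzeroE)
  obtain r' where r': "r' \<in> laurent" "b = r' * X n' * ST j' k'"
    using b unfolding g' by (rule homogeneous_nonzeroE)
  have unit: "ring_unit (ST j k)" for j k
    by (intro ring_unit_mult ipow_unit ss' tt')
  have comm: "ST j k * c = c * ST j k"
    if "c * s = s * c" "c * s' = s' * c" "c * t = t * c" "c * t' = t' * c" for c
  proof -
    have "c * ipow s s' j = ipow s s' j * c" "c * ipow t t' k = ipow t t' k * c"
      using that by (simp_all add: ipow_commute)
    then show ?thesis
      using skew_commute_mult[of c "ipow s s' j" 1 "ipow t t' k" 1] by simp
  qed
  have comm_X: "ST j k * X n' = X n' * ST j k"
    by (rule comm; rule ipow_commute[symmetric])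
       (simp_all add: sx sy tx ty x_s' y_s' x_t' y_t')
  obtain m f where r'_eq: "r' = z' ^ m * ev f"
    using r'(1) by (auto simp: laurent_def)
  have comm_r': "ST j k * r' = r' * ST j k"
  proof -
    have "c * r' = r' * c" if "c * z = z * c" "c * z' = z' * c" for c
      using skew_commute_mult[of c "z' ^ m" 1 "ev f" 1] commute_poly_eval[OF that(1), of f]
        power_commuting_commutes[OF that(2)[symmetric], of m]
      by (simp add: r'_eq)
    then show ?thesis
      by (intro comm) (simp_all add: sz tz s_z' t_z' z_s' z_t' z'_s' z'_t')
  qed
  obtain r2 where r2: "r2 \<in> laurent" "X n * r' = r2 * X n"
    using moves_past_X r'(1) unfolding moves_past_laurent_def by blast
  obtain r3 where r3: "r3 \<in> laurent" "X n * X n' = r3 * X (n + n')"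
    using X_mult_X by blast
  have "a * b = r * X n * (ST j k * r') * X n' * ST j' k'"
    by (simp only: r(2) r'(2) mult.assoc)
  also have "\<dots> = r * (X n * r') * (ST j k * X n') * ST j' k'"
    by (subst comm_r') (simp only: mult.assoc)
  also have "\<dots> = r * r2 * (X n * X n') * (ST j k * ST j' k')"
    by (subst comm_X, subst r2(2)) (simp only: mult.assoc)
  also have "\<dots> = r * r2 * r3 * X (n + n') * (ST j k * ST j' k')"
    by (subst r3(2)) (simp only: mult.assoc)
  finally have "r * r2 * r3 * X (n + n') * (ST j k * ST j' k') = 0 * (ST j k * ST j' k')"
    using \<open>a * b = 0\<close> by simp
  then have "r * r2 * r3 * X (n + n') = 0"
    using ring_unit_mult_right_cancel[OF ring_unit_mult[OF unit unit]] by blast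
  then show False
    using laurent_mult_X_nonzero[OF laurent_mult[OF laurent_mult[OF r(1) r2(1)] r3(1)]] by blast
qed

lemma inverse_homogeneous:
  assumes "u * v = 1"
  obtains g where "u \<in> homogeneous g" "v \<in> homogeneous (- g)"
proof -
  have "\<exists>g. u \<in> homogeneous g \<and> v \<in> homogeneous (- g)"
    by (rule units_homogeneous[OF _ assms]) (rule homogeneous_no_zero_divisors)
  then show thesis
    using that by blast
qed


section \<open>Units and the images of $z$ under automorphisms\<close>

lemma homogeneous_degree_unique:
  assumes "a \<in> homogeneous g" "a \<in> homogeneous g'" "a \<noteq> 0"
  shows "g = g'"
proof (rule ccontr)
  assume "g \<noteq> g'"
  then have "(if g = g then a else - a) = 0"
    using assms(1,2) homogeneous_uminus
    by (intro H_independent[of "{g, g'}" "\<lambda>f. if f = g then a else - a"])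
       (auto simp del: homogeneous.simps)
  with assms(3) show False
    by simp
qed

lemma x_nonzero: "x \<noteq> 0"
  using laurent_nonzero[OF xy_laurent] by auto

text \<open>A left inverse of \<open>x\<close> would have degree \<open>-1\<close>, hence be of the form \<open>z\<^sup>-\<^sup>m f(z) y\<close>, and so
  \<open>f(z) (z - 1)\<close> would be a monomial in \<open>z\<close>.\<close>

lemma x_no_left_inverse: "c * x \<noteq> 1"
proof
  assume "c * x = 1"
  then obtain g where g: "c \<in> homogeneous g" "x \<in> homogeneous (- g)"
    by (rule inverse_homogeneous)
  have "- g = (1, 0, 0)"
    using g(2) homogeneous_x x_nonzero by (rule homogeneous_degree_unique)
  then have "g = (- 1, 0, 0)"
    by (cases g) simp
  with g(1) have "c \<in> homogeneous (- 1, 0, 0)"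
    by (simp only:)
  moreover have "c \<noteq> 0"
    using \<open>c * x = 1\<close> by auto
  ultimately obtain r where r: "r \<in> laurent" "c = r * X (- 1) * ST 0 0"
    by (rule homogeneous_nonzeroE)
  then obtain m f where f: "f \<noteq> 0" "r = z' ^ m * ev f"
    by (auto simp: laurent_def)
  have "c = r * y"
    using r(2) ipow_minus_of_nat[of x y 1] by simp
  then have "z' ^ m * ev f * y * x = 1"
    using \<open>c * x = 1\<close> f(2) by simp
  then have "z' ^ m * ev (f * [:- 1, 1:]) = scale (p - 1) 1"
    unfolding poly_eval_mult ev_yx scale_mult_right by (simp only: mult.assoc)
  then have "ev (f * [:- 1, 1:]) = z ^ m * scale (p - 1) 1"
    by (metis z'_power_cancel)
  then have "ev (f * [:- 1, 1:]) = ev (monom (p - 1) m)"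
    by (simp only: poly_eval_monom mult_scale_one)
  then have "f * [:- 1, 1:] = monom (p - 1) m"
    by (simp only: ev_inject)
  then have "poly (f * [:- 1, 1:]) 1 = poly (monom (p - 1) m) 1"
    by (simp only:)
  then show False
    using p_minus_1 by (simp add: poly_monom)
qed

text \<open>Such an element ends in a factor \<open>x\<close>, up to a unit.\<close>

lemma positive_degree_no_left_inverse:
  assumes a: "a \<in> homogeneous (n, j, k)" and "n > 0"
  shows "b * a \<noteq> 1"
proof
  assume "b * a = 1"
  then have "a \<noteq> 0"
    by auto
  with a obtain r where r: "a = r * X n * ST j k"
    by (rule homogeneous_nonzeroE)
  obtain l where "n = int (Suc l)"
    using \<open>n > 0\<close> by (cases n rule: int_cases3) (auto dest!: gr0_implies_Suc)
  then have X: "X n = x ^ l * x"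
    by (simp only: ipow_of_nat power_Suc2)
  have "ring_unit (ST j k)"
    by (intro ring_unit_mult ipow_unit ss' tt')
  then obtain w where w: "ST j k * w = 1" "w * ST j k = 1"
    unfolding ring_unit_def by blast
  have "b * r * x ^ l * x * ST j k = w * ST j k"
    using \<open>b * a = 1\<close> by (simp only: r X w mult.assoc)
  then have "b * r * x ^ l * x = w"
    using ring_unit_mult_right_cancel[OF \<open>ring_unit (ST j k)\<close>] by blast
  then have "ST j k * b * r * x ^ l * x = 1"
    using w(1) by (metis mult.assoc)
  then show False
    using x_no_left_inverse by blast
qed

text \<open>A unit and its inverse are homogeneous of opposite degrees; neither degree in \<open>x\<close> can be positive, so
  both are \<open>0\<close>, and degree \<open>0\<close> in \<open>x\<close> means commuting with \<open>z\<close>.\<close>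

lemma unit_commutes_z:
  assumes "u * v = 1" "v * u = 1"
  shows "u * z = z * u"
proof -
  obtain g where g: "u \<in> homogeneous g" "v \<in> homogeneous (- g)"
    using assms(1) by (rule inverse_homogeneous)
  obtain n j k where njk: "g = (n, j, k)" by (cases g)
  have "\<not> n > 0"
    using positive_degree_no_left_inverse[of u n j k v] assms(2) g(1) njk by blast
  moreover have "\<not> - n > 0"
    using positive_degree_no_left_inverse[of v "- n" "- j" "- k" u] assms(1) g(2) njk
    by (metis uminus_Pair)
  ultimately have "n = 0"
    by simp
  with g(1) njk show ?thesis
    by simp
qed

text \<open>If \<open>u = z\<^sup>-\<^sup>m f(z)\<close> and \<open>v = z\<^sup>-\<^sup>n g(z)\<close> are inverse to each other, then \<open>f g\<close> is a power of the variable, and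
  so \<open>f\<close> is a monomial.\<close>

lemma unit_of_degree_zero:
  assumes "u * v = 1" "u \<in> homogeneous 0" "v \<in> homogeneous 0"
  shows "\<exists>c i. c \<noteq> 0 \<and> u = scale c (ipow z z' i)"
proof -
  have form: "\<exists>m f. f \<noteq> 0 \<and> a = z' ^ m * ev f"
    if a: "a \<in> homogeneous 0" "a \<noteq> 0" for a
  proof -
    have "a \<in> homogeneous (0, 0, 0)"
      using a(1) by (simp only: zero_prod_def)
    then obtain r where "r \<in> laurent" "a = r * X 0 * ST 0 0"
      using a(2) by (rule homogeneous_nonzeroE)
    then show ?thesis
      by (auto simp: laurent_def)
  qed
  have "u \<noteq> 0" "v \<noteq> 0"
    using assms(1) by auto
  then obtain m f n g where f: "f \<noteq> 0" "u = z' ^ m * ev f" and g: "g \<noteq> 0" "v = z' ^ n * ev g"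
    using form[OF assms(2)] form[OF assms(3)] by blast
  have "ev f = z ^ m * u" "ev g = z ^ n * v"
    by (simp_all add: f g z'_power_cancel)
  moreover have "u * z ^ n = z ^ n * u"
  proof -
    have "u * z = z * u"
      using assms(2) by (simp add: zero_prod_def)
    then show ?thesis
      by (metis power_commuting_commutes)
  qed
  ultimately have "ev (f * g) = z ^ m * (z ^ n * u) * v"
    by (simp only: poly_eval_mult mult.assoc) (simp only: flip: mult.assoc)
  also have "\<dots> = ev (monom 1 (m + n))"
    by (simp add: poly_eval_monom power_add mult.assoc assms(1))
  finally have "f * g = monom 1 (m + n)"
    by (simp only: ev_inject)
  then obtain c l where c: "c \<noteq> 0" "f = monom c l"
    using divisor_of_monom[of f g 1 "m + n"] by auto
  have "z' ^ m * z ^ l = ipow z z' (int l - int m)"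
  proof (induction m)
    case (Suc m)
    have "z' ^ Suc m * z ^ l = z' * ipow z z' (int l - int m)"
      by (simp add: mult.assoc flip: Suc.IH)
    then show ?case
      by (simp add: mult_ipow_minus[OF zz'(2)] algebra_simps)
  qed simp
  then have "u = scale c (ipow z z' (int l - int m))"
    by (simp add: f(2) c(2) poly_eval_monom scale_mult_right)
  with c(1) show ?thesis
    by blast
qed

text \<open>An automorphism preserves the group of units, and \<open>z\<close> is central in that group. Central units
  commute with \<open>z\<close>, \<open>t\<close> and \<open>s\<close>, hence have degree \<open>0\<close>.\<close>

lemma automorphism_image_z:
  assumes "k_algebra_hom scale scale \<phi>" "bij \<phi>"
  shows "\<exists>c i. c \<noteq> 0 \<and> \<phi> z = scale c (ipow z z' i)"
proof -
  interpret \<phi>: k_algebra_hom scale scale \<phi> by fact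
  have uv: "\<phi> z * \<phi> z' = 1" "\<phi> z' * \<phi> z = 1"
    by (simp_all add: zz' \<phi>.hom_one flip: \<phi>.hom_mult)
  have central: "\<phi> z * w = w * \<phi> z" if w: "w * w' = 1" "w' * w = 1" for w w'
  proof -
    obtain v v' where v: "w = \<phi> v" "w' = \<phi> v'"
      using \<open>bij \<phi>\<close> by (metis bij_pointE)
    then have "\<phi> (v * v') = \<phi> 1" "\<phi> (v' * v) = \<phi> 1"
      using w by (simp_all add: \<phi>.hom_mult \<phi>.hom_one)
    then have "v * v' = 1" "v' * v = 1"
      using bij_is_inj[OF \<open>bij \<phi>\<close>] by (auto dest: injD)
    then have "v * z = z * v"
      by (rule unit_commutes_z)
    then show ?thesis
      by (metis v(1) \<phi>.hom_mult)
  qed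
  obtain g where g: "\<phi> z \<in> homogeneous g" "\<phi> z' \<in> homogeneous (- g)"
    using uv(1) by (rule inverse_homogeneous)
  obtain n j k where njk: "g = (n, j, k)" by (cases g)
  have "\<phi> z \<noteq> 0"
    using uv(1) by auto
  have eigenvalue_one: "c = 1" if "a = scale c a" "a \<noteq> 0" for a c
    using that scale_cancel_right[of 1 a c] by simp
  have prod_nonzero: "a * \<phi> z \<noteq> 0" if "a * b = 1" "b * a = 1" for a b
    using that \<open>\<phi> z \<noteq> 0\<close> by (metis mult.assoc mult_1 mult_zero_right)
  have "q powi j = 1"
    by (rule eigenvalue_one[of "t * \<phi> z"])
       (use g(1) central[OF tt'] prod_nonzero[OF tt'] in \<open>auto simp: njk\<close>)
  moreover have "q powi k = 1"
    by (rule eigenvalue_one[of "s * \<phi> z"])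
       (use g(1) central[OF ss'] prod_nonzero[OF ss'] in \<open>auto simp: njk\<close>)
  moreover have "p powi n = 1"
    by (rule eigenvalue_one[of "z * \<phi> z"])
       (use g(1) central[OF zz'] prod_nonzero[OF zz'] in \<open>auto simp: njk\<close>)
  ultimately have "n = 0" "j = 0" "k = 0"
    using powi_eq_powi_iff[OF p_nonzero p_no_root, of n 0]
      powi_eq_powi_iff[OF q_nonzero q_no_root, of j 0]
      powi_eq_powi_iff[OF q_nonzero q_no_root, of k 0] by simp_all
  then have "g = 0"
    by (simp add: njk zero_prod_def)
  then show ?thesis
    using unit_of_degree_zero[OF uv(1)] g by simp
qed

text \<open>Otherwise \<open>z\<close> would satisfy a polynomial equation.\<close>

lemma z_eq_scale_ipow:
  assumes "z = scale e (ipow z z' n)"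
  shows "n = 1"
proof (cases "0 \<le> n")
  case True
  then obtain m where n: "n = int m"
    by (auto elim: nonneg_int_cases)
  then have "ev (monom 1 1) = ev (monom e m)"
    using assms by (simp add: poly_eval_monom)
  then have "monom 1 1 = monom e m"
    by (simp only: ev_inject)
  then show ?thesis
    by (simp add: n monom_eq_iff')
next
  case False
  then obtain m where n: "n = - int m"
    by (metis int_cases2 of_nat_0_le_iff)
  have "z = scale e (z' ^ m)"
    using assms unfolding n ipow_minus_of_nat .
  then have "z ^ m * z = scale e 1"
    using z'_power_cancel[of m 1] by (metis mult_1_right scale_mult_right)
  then have "ev (monom 1 (Suc m)) = ev (monom e 0)"
    by (simp only: poly_eval_monom scale_one power_Suc2 power_0)
  then have "monom 1 (Suc m) = monom e 0"
    by (simp only: ev_inject)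
  then show ?thesis
    by (simp add: monom_eq_iff')
qed

lemma image_inverse:
  assumes "k_algebra_hom scale scale \<phi>" and "\<phi> z * w = 1"
  shows "\<phi> z' = w"
proof -
  interpret \<phi>: k_algebra_hom scale scale \<phi> by fact
  have "\<phi> z' * (\<phi> z * w) = w"
    by (simp add: zz' \<phi>.hom_one flip: mult.assoc \<phi>.hom_mult)
  with assms(2) show ?thesis
    by simp
qed


text \<open>If \<open>\<phi>(z) = c z\<^sup>i\<close> and \<open>\<phi>\<^sup>-\<^sup>1(z) = d z\<^sup>j\<close>, then \<open>z\<close> is a scalar multiple of \<open>z\<^sup>i\<^sup>j\<close>.\<close>

lemma automorphism_type:
  assumes "k_algebra_hom scale scale \<phi>" "bij \<phi>"
  shows "\<exists>c. c \<noteq> 0 \<and> (\<phi> z = scale c z \<or> \<phi> z = scale c z')"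
proof -
  interpret \<phi>: k_algebra_hom scale scale \<phi> by fact
  obtain c i where c: "c \<noteq> 0" "\<phi> z = scale c (ipow z z' i)"
    using automorphism_image_z[OF assms] by blast
  obtain d j where d: "d \<noteq> 0" "inv_into UNIV \<phi> z = scale d (ipow z z' j)"
    using automorphism_image_z[OF k_algebra_hom_inv[OF assms]] by blast
  have \<phi>_z': "\<phi> z' = scale (inverse c) (ipow z z' (- i))"
    using c(1) by (intro image_inverse[OF assms(1)])
       (simp add: c(2) scale_mult_left scale_mult_right ipow_mult_ipow_minus[OF zz'])
  have power: "scale e a ^ m = scale (e ^ m) (a ^ m)" for e a m
    by (induction m) (simp_all add: scale_mult_left scale_mult_right mult.commute)
  have "\<exists>e. \<phi> (ipow z z' j) = scale e (ipow z z' (i * j))"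
  proof (cases j rule: int_cases2)
    case (nonneg m)
    then show ?thesis
      by (auto simp: \<phi>.hom_power c(2) power ipow_mult_power)
  next
    case (nonpos m)
    have "\<phi> (ipow z z' j) = scale (inverse c ^ m) (ipow z z' (- i * int m))"
      by (simp only: nonpos ipow_minus_of_nat \<phi>.hom_power \<phi>_z' power ipow_mult_power)
    then show ?thesis
      by (auto simp: nonpos)
  qed
  then obtain e where e: "\<phi> (ipow z z' j) = scale e (ipow z z' (i * j))" ..
  have "z = \<phi> (scale d (ipow z z' j))"
    using assms(2) by (simp add: bij_is_surj surj_f_inv_f flip: d(2))
  also have "\<dots> = scale (d * e) (ipow z z' (i * j))"
    by (simp add: \<phi>.hom_scale e)
  finally have "i * j = 1"
    by (rule z_eq_scale_ipow)
  then have "i = 1 \<or> i = - 1"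
    by (auto simp: zmult_eq_1_iff)
  then have "\<phi> z = scale c z \<or> \<phi> z = scale c z'"
    using c(2) ipow_of_nat[of z z' 1] ipow_minus_of_nat[of z z' 1] by auto
  with c(1) show ?thesis
    by blast
qed

lemma type_unique: "scale c z \<noteq> scale d z'" if "c \<noteq> 0"
proof
  assume "scale c z = scale d z'"
  then have "scale (inverse c) (scale c z) = scale (inverse c) (scale d z')"
    by simp
  with that have "z = scale (inverse c * d) z'"
    by simp
  then have "z = scale (inverse c * d) (ipow z z' (- 1))"
    using ipow_minus_of_nat[of z z' 1] by simp
  from z_eq_scale_ipow[OF this] show False
    by simp
qed

lemma ring_inv_z: "ring_inv z = z'"
  by (rule ring_inv_eqI[OF zz'])

lemma positive_or_negative:
  assumes "k_algebra_hom scale scale \<phi>" "bij \<phi>"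
  shows "negative_type scale z \<phi> \<longleftrightarrow> \<not> positive_type scale z \<phi>"
  using automorphism_type[OF assms] type_unique
  unfolding negative_type_def positive_type_def ring_inv_z by metis

lemma positive_type_comp:
  assumes \<phi>: "k_algebra_hom scale scale \<phi>" "bij \<phi>" and \<chi>: "k_algebra_hom scale scale \<chi>" "bij \<chi>"
  shows "positive_type scale z (\<phi> \<circ> \<chi>) \<longleftrightarrow>
    (positive_type scale z \<phi> \<longleftrightarrow> positive_type scale z \<chi>)"
proof -
  interpret \<phi>: k_algebra_hom scale scale \<phi> by fact
  obtain c where c: "c \<noteq> 0" "\<phi> z = scale c z \<or> \<phi> z = scale c z'"
    using automorphism_type[OF \<phi>] by blast
  obtain d where d: "d \<noteq> 0" "\<chi> z = scale d z \<or> \<chi> z = scale d z'"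
    using automorphism_type[OF \<chi>] by blast
  have inv: "\<phi> z' = scale (inverse c) z'" if "\<phi> z = scale c z"
    by (rule image_inverse[OF \<phi>(1)]) (use c that in \<open>simp add: scale_mult_left scale_mult_right zz'\<close>)
  have inv': "\<phi> z' = scale (inverse c) z" if "\<phi> z = scale c z'"
    by (rule image_inverse[OF \<phi>(1)]) (use c that in \<open>simp add: scale_mult_left scale_mult_right zz'\<close>)
  have pos: "positive_type scale z \<theta>" if "\<theta> z = scale e z" "e \<noteq> 0" for \<theta> e
    using that unfolding positive_type_def by blast
  have neg: "\<not> positive_type scale z \<theta>" if "\<theta> z = scale e z'" for \<theta> e
    using that type_unique unfolding positive_type_def by metis
  show ?thesis
    using c(2) d(2)
  proof (elim disjE)
    assume 1: "\<phi> z = scale c z" "\<chi> z = scale d z"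
    then have "(\<phi> \<circ> \<chi>) z = scale (d * c) z"
      by (simp add: \<phi>.hom_scale)
    then show ?thesis
      using pos[of \<phi> c] pos[of \<chi> d] pos[of "\<phi> \<circ> \<chi>" "d * c"] c(1) d(1) 1 by simp
  next
    assume 1: "\<phi> z = scale c z" "\<chi> z = scale d z'"
    then have "(\<phi> \<circ> \<chi>) z = scale (d * inverse c) z'"
      by (simp add: \<phi>.hom_scale inv)
    then show ?thesis
      using pos[of \<phi> c] neg[of \<chi> d] neg[of "\<phi> \<circ> \<chi>" "d * inverse c"] c(1) d(1) 1 by simp
  next
    assume 1: "\<phi> z = scale c z'" "\<chi> z = scale d z"
    then have "(\<phi> \<circ> \<chi>) z = scale (d * c) z'"
      by (simp add: \<phi>.hom_scale)
    then show ?thesis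
      using neg[of \<phi> c] pos[of \<chi> d] neg[of "\<phi> \<circ> \<chi>" "d * c"] c(1) d(1) 1 by simp
  next
    assume 1: "\<phi> z = scale c z'" "\<chi> z = scale d z'"
    then have "(\<phi> \<circ> \<chi>) z = scale (d * inverse c) z"
      by (simp add: \<phi>.hom_scale inv')
    then show ?thesis
      using neg[of \<phi> c] neg[of \<chi> d] pos[of "\<phi> \<circ> \<chi>" "d * inverse c"] c(1) d(1) 1 by simp
  qed
qed

text \<open>Homomorphisms preserve inverses, so agreement on the generators extends to \<open>z\<^sup>-\<^sup>1\<close>, \<open>s\<^sup>-\<^sup>1\<close> and \<open>t\<^sup>-\<^sup>1\<close>.\<close>

lemma hom_eqI:
  assumes f: "k_algebra_hom scale scaleB f" and g: "k_algebra_hom scale scaleB g"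
    and eq: "f x = g x" "f y = g y" "f s = g s" "f t = g t"
  shows "f = g"
proof
  interpret f: k_algebra_hom scale scaleB f by fact
  interpret g: k_algebra_hom scale scaleB g by fact
  have inverse_eq: "f b' = g b'" if "f b = g b" "b * b' = 1" "b' * b = 1" for b b'
  proof -
    have "f b' * f b = 1" "g b * g b' = 1"
      by (simp_all only: that(2,3) f.hom_one g.hom_one flip: f.hom_mult g.hom_mult)
    then have "f b' = f b' * (f b * g b')"
      by (simp add: that(1))
    also have "\<dots> = g b'"
      using \<open>f b' * f b = 1\<close> by (simp flip: mult.assoc)
    finally show ?thesis .
  qed
  have "f z = g z"
    by (simp add: z_eq f.hom_simps g.hom_simps eq)
  note inv = inverse_eq[OF this zz'] inverse_eq[OF eq(3) ss'] inverse_eq[OF eq(4) tt']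
  show "f b = g b" for b
    by (induction b rule: generated) (simp_all add: f.hom_simps g.hom_simps eq inv)
qed

section \<open>The substitutions behind the negative automorphism\<close>

lemma z'_yx: "z' = 1 - scale (p - 1) (z' * (y * x))"
proof -
  have "z' * z = scale (p - 1) (z' * (y * x)) + z'"
    by (subst z_yx) (simp only: distrib_left scale_mult_right mult_1_right)
  then show ?thesis
    by (simp add: zz' eq_diff_eq add.commute)
qed

lemma z'_xy: "z' * (x * y) = 1 + z' * (y * x)"
proof -
  have "z' * (x * y) = z' * z + z' * (y * x)"
    by (simp add: z_eq right_diff_distrib)
  then show ?thesis
    by (simp add: zz')
qed

text \<open>For each of the pairs \<open>(y, - p\<^sup>-\<^sup>1 z\<^sup>-\<^sup>1 x)\<close> and \<open>(- z\<^sup>-\<^sup>1 y, x)\<close>, \<open>u\<close> and \<open>v\<close> are the products in the given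
  and in the reversed order. The two equations are the defining relation of \<open>x\<close> and \<open>y\<close> for these
  pairs, and the image of \<open>z\<close> under the resulting substitutions.\<close>

lemma swapped_products:
  defines "u \<equiv> - (z' * (y * x))" and "v \<equiv> - scale (inverse p) (1 + z' * (y * x))"
  shows "u = scale p v + 1" "u - v = scale (inverse p) z'"
proof -
  show "u = scale p v + 1"
    by (simp add: u_def v_def p_nonzero)
  have "scale (inverse p) z' = scale (inverse p) (1 - scale (p - 1) (z' * (y * x)))"
    using z'_yx by simp
  then show "u - v = scale (inverse p) z'"
    by (simp add: u_def v_def p_nonzero scale_right_diff_distrib scale_right_distrib
        scale_left_diff_distrib right_diff_distrib)
qed

lemma psi_minus_products:
  "y * scale (- inverse p) (z' * x) = - (z' * (y * x))"
  "scale (- inverse p) (z' * x) * y = - scale (inverse p) (1 + z' * (y * x))"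
proof -
  have "y * (z' * x) = scale p (z' * (y * x))"
    by (simp add: yz' scale_mult_left flip: mult.assoc)
  then show "y * scale (- inverse p) (z' * x) = - (z' * (y * x))"
    by (simp add: scale_mult_right p_nonzero)
  show "scale (- inverse p) (z' * x) * y = - scale (inverse p) (1 + z' * (y * x))"
    by (simp add: scale_mult_left mult.assoc z'_xy)
qed

lemma psi_minus_inverse_products:
  "- (z' * y) * x = - (z' * (y * x))"
  "x * - (z' * y) = - scale (inverse p) (1 + z' * (y * x))"
proof -
  have "x * (z' * y) = scale (inverse p) (z' * (x * y))"
    by (simp add: xz' scale_mult_left flip: mult.assoc)
  then show "x * - (z' * y) = - scale (inverse p) (1 + z' * (y * x))"
    by (simp add: z'_xy)
qed (simp add: mult.assoc)

end

section \<open>From the presentation to the localized algebra\<close>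

abbreviation xyst_family :: "'a \<Rightarrow> 'a \<Rightarrow> 'a \<Rightarrow> 'a \<Rightarrow> xyst \<Rightarrow> 'a" where
  "xyst_family x y s t \<equiv> (\<lambda>g. case g of GX \<Rightarrow> x | GY \<Rightarrow> y | GS \<Rightarrow> s | GT \<Rightarrow> t)"

text \<open>Used in both directions: the presentation map of the algebra kills the relators, which gives the
  relations in it; and elements that satisfy the relations give an evaluation that kills the relators.\<close>

lemma A_relators_vanish_iff:
  assumes "k_algebra_hom free_scale scale \<pi>" "\<And>g. \<pi> (free_gen g) = xyst_family x y s t g"
  shows "(\<forall>r\<in>A_relators p q. \<pi> r = 0) \<longleftrightarrow>
    x * y = scale p (y * x) + 1 \<and> s * t = scale q (t * s) \<and>
    s * x = x * s \<and> s * y = y * s \<and> t * x = x * t \<and> t * y = y * t"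
proof -
  interpret \<pi>: k_algebra_hom free_scale scale \<pi> by fact
  show ?thesis
    by (auto simp: A_relators_def Let_def \<pi>.hom_simps assms(2) diff_eq_eq add.commute)
qed

lemma is_A_weyl_algebra:
  assumes "is_A p q scale x y s t" "p \<noteq> 0" "q \<noteq> 0"
  shows "weyl_algebra scale p q x y (x * y - y * x) s t"
proof -
  obtain \<pi> where \<pi>: "k_algebra_hom free_scale scale \<pi>" "\<And>g. \<pi> (free_gen g) = xyst_family x y s t g"
    and ker: "{f. \<pi> f = 0} = two_sided_ideal hull A_relators p q"
    using assms(1) unfolding is_A_def presented_by_def by blast
  interpret \<pi>: k_algebra_hom free_scale scale \<pi> by fact
  have "\<forall>r\<in>A_relators p q. \<pi> r = 0"
    using ker hull_subset[of "A_relators p q" two_sided_ideal] by blast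
  then show ?thesis
    using A_relators_vanish_iff[OF \<pi>, of p q] assms(2,3)
    by unfold_locales auto
qed

lemma is_A_hom_exists:
  assumes A: "is_A p q scaleA x y s t" and "k_algebra scaleB"
    and "x' * y' = scaleB p (y' * x') + 1" "s' * t' = scaleB q (t' * s')"
    and "s' * x' = x' * s'" "s' * y' = y' * s'" "t' * x' = x' * t'" "t' * y' = y' * t'"
  obtains f where "k_algebra_hom scaleA scaleB f" "f x = x'" "f y = y'" "f s = s'" "f t = t'"
proof -
  interpret B: k_algebra scaleB by fact
  let ?h = "xyst_family x' y' s' t'"
  have "\<forall>r\<in>A_relators p q. B.free_eval ?h r = 0"
    using A_relators_vanish_iff[OF B.k_algebra_hom_free_eval B.free_eval_gen, of p q] assms by simp
  then obtain f where f: "k_algebra_hom scaleA scaleB f" "\<And>g. f (xyst_family x y s t g) = ?h g"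
    using presented_by_hom_exists[OF A[unfolded is_A_def] \<open>k_algebra scaleB\<close>, of ?h] by blast
  show thesis
    using that[OF f(1)] f(2)[of GX] f(2)[of GY] f(2)[of GS] f(2)[of GT] by simp
qed

text \<open>This is the right Ore condition in its strongest form, \<open>A d \<subseteq> d A\<close>. It holds for \<open>z\<close>, \<open>s\<close> and \<open>t\<close>
  because they commute with every generator up to a scalar.\<close>

definition normal_element :: "'a::ring_1 \<Rightarrow> bool" where
  "normal_element d \<longleftrightarrow> (\<forall>a. \<exists>a'. a * d = d * a')"

lemma normal_element_mult:
  assumes "normal_element d" "normal_element e"
  shows "normal_element (d * e)"
  unfolding normal_element_def
proof
  fix a
  obtain a' where "a * d = d * a'"
    using assms(1) unfolding normal_element_def by blast
  moreover obtain a'' where "a' * e = e * a''"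
    using assms(2) unfolding normal_element_def by blast
  ultimately have "a * (d * e) = d * e * a''"
    by (metis mult.assoc)
  then show "\<exists>a'. a * (d * e) = d * e * a'" ..
qed

lemma normal_element_power: "normal_element d \<Longrightarrow> normal_element (d ^ n)"
proof (induction n)
  case 0
  show ?case
    by (simp add: normal_element_def)
qed (simp add: normal_element_mult)

lemma (in k_algebra) normal_element_scale:
  assumes "normal_element d"
  shows "normal_element (scale c d)"
  using assms unfolding normal_element_def by (metis scale_mult_left scale_mult_right)

lemma normal_element_if_generators:
  assumes A: "presented_by scaleA gens R"
    and gens: "\<And>g. \<exists>c. gens g * d = scaleA c (d * gens g)"
  shows "normal_element d"
  unfolding normal_element_def
proof
  fix a
  interpret k_algebra scaleA
    using A by (rule presented_by_k_algebra)
  show "\<exists>a'. a * d = d * a'"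
    using A
  proof (induction a rule: presented_by_induct)
    case one
    have "1 * d = d * 1" by simp
    then show ?case ..
  next
    case (add a b)
    then show ?case by (metis distrib_left distrib_right)
  next
    case (scale c a)
    then show ?case by (metis scale_mult_left scale_mult_right)
  next
    case (gen g a)
    then obtain a' where a': "a * d = d * a'" ..
    obtain c where c: "gens g * d = scaleA c (d * gens g)"
      using gens by blast
    have "gens g * a * d = gens g * d * a'"
      by (simp only: a' mult.assoc)
    also have "\<dots> = d * scaleA c (gens g * a')"
      by (simp only: c scale_mult_left scale_mult_right mult.assoc)
    finally show ?case ..
  qed
qed

lemma zst_monomialsI: "c \<noteq> 0 \<Longrightarrow> scale c (z ^ i * s ^ j * t ^ k) \<in> zst_monomials scale z s t"
  unfolding zst_monomials_def by blast

context weyl_algebra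
begin

lemma mem_zst_monomials:
  "1 \<in> zst_monomials scale z s t" "z \<in> zst_monomials scale z s t"
  "s \<in> zst_monomials scale z s t" "t \<in> zst_monomials scale z s t"
  using zst_monomialsI[of 1 scale z 0 s 0 t 0] zst_monomialsI[of 1 scale z 1 s 0 t 0]
    zst_monomialsI[of 1 scale z 0 s 1 t 0] zst_monomialsI[of 1 scale z 0 s 0 t 1] by simp_all

text \<open>Moving \<open>s\<^sup>j\<^sup>'\<close> past \<open>t\<^sup>k\<close> costs a power of \<open>q\<close>, which the scalar factor absorbs.\<close>

lemma zst_monomials_mult:
  assumes "d \<in> zst_monomials scale z s t" "e \<in> zst_monomials scale z s t"
  shows "d * e \<in> zst_monomials scale z s t"
proof -
  obtain c i j k where d: "c \<noteq> 0" "d = scale c (z ^ i * s ^ j * t ^ k)"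
    using assms(1) unfolding zst_monomials_def by blast
  obtain c' i' j' k' where e: "c' \<noteq> 0" "e = scale c' (z ^ i' * s ^ j' * t ^ k')"
    using assms(2) unfolding zst_monomials_def by blast
  have "t ^ k * z ^ i' = z ^ i' * t ^ k" "s ^ j * z ^ i' = z ^ i' * s ^ j"
    using tz sz by (metis power_commuting_commutes)+
  then have zi: "s ^ j * (t ^ k * z ^ i') = z ^ i' * (s ^ j * t ^ k)"
    by (metis mult.assoc)
  have "s ^ j' * t = scale (q ^ j') (t * s ^ j')"
    using skew_commute_power[OF ts, of j'] q_nonzero by (simp add: power_inverse)
  then have "s ^ j' * t ^ k = scale ((q ^ j') ^ k) (t ^ k * s ^ j')"
    by (rule skew_commute_power)
  then have sj: "t ^ k * s ^ j' = scale (inverse ((q ^ j') ^ k)) (s ^ j' * t ^ k)"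
    by (rule skew_commute_sym) (simp add: q_nonzero)
  have "d * e = scale (c * c') (z ^ i * (s ^ j * (t ^ k * z ^ i')) * s ^ j' * t ^ k')"
    by (simp add: d e scale_mult_left scale_mult_right mult.assoc mult.commute)
  also have "\<dots> = scale (c * c') (z ^ (i + i') * s ^ j * (t ^ k * s ^ j') * t ^ k')"
    by (simp only: zi power_add mult.assoc)
  also have "\<dots> = scale (c * c' * inverse ((q ^ j') ^ k)) (z ^ (i + i') * s ^ (j + j') * t ^ (k + k'))"
    by (simp only: sj power_add scale_mult_left scale_mult_right scale_scale mult.assoc)
  finally show ?thesis
    using d(1) e(1) q_nonzero by (simp add: zst_monomialsI)
qed

end

lemma is_A_normal_monomials:
  assumes A: "is_A p q scale x y s t" and "weyl_algebra scale p q x y z s t"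
    and d: "d \<in> zst_monomials scale z s t"
  shows "normal_element d"
proof -
  interpret weyl_algebra scale p q x y z s t by fact
  have normal: "normal_element d"
    if "x * d = scale a (d * x)" "y * d = scale b (d * y)" "s * d = scale c (d * s)" "t * d = scale e (d * t)"
    for d a b c e
  proof (rule normal_element_if_generators[OF A[unfolded is_A_def]])
    show "\<exists>c. xyst_family x y s t g * d = scale c (d * xyst_family x y s t g)" for g
      using that by (cases g) auto
  qed
  have "normal_element z"
    by (rule normal[of z p "inverse p" 1 1]) (simp_all add: xz yz sz tz)
  moreover have "normal_element s"
    by (rule normal[of s 1 1 1 "inverse q"]) (simp_all add: sx sy ts)
  moreover have "normal_element t"
    by (rule normal[of t 1 1 q 1]) (simp_all add: tx ty st)
  ultimately show ?thesis
    using d unfolding zst_monomials_def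
    by (auto intro!: normal_element_scale normal_element_mult normal_element_power)
qed

locale ore_localized_weyl_algebra =
  fixes p q :: "'k::field"
    and scaleA :: "'k \<Rightarrow> 'a::ring_1 \<Rightarrow> 'a" and scaleL :: "'k \<Rightarrow> 'l::ring_1 \<Rightarrow> 'l"
    and x y z s t :: 'a and \<iota> :: "'a \<Rightarrow> 'l"
  assumes p0: "p \<noteq> 0" and q0: "q \<noteq> 0"
    and p_root: "\<forall>n::nat. n > 0 \<longrightarrow> p ^ n \<noteq> 1"
    and q_root: "\<forall>n::nat. n > 0 \<longrightarrow> q ^ n \<noteq> 1"
    and is_A: "is_A p q scaleA x y s t"
    and z: "z = x * y - y * x"
    and ore: "is_ore_localization scaleA scaleL (zst_monomials scaleA z s t) \<iota>"
begin

sublocale A: weyl_algebra scaleA p q x y z s t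
  using is_A_weyl_algebra[OF is_A p0 q0] z by simp

sublocale \<iota>: k_algebra_hom scaleA scaleL \<iota>
  using ore by (simp add: is_ore_localization_def)

lemma unit_\<iota>: "d \<in> zst_monomials scaleA z s t \<Longrightarrow> ring_unit (\<iota> d)"
  using ore by (simp add: is_ore_localization_def)

lemmas \<iota>_inverses =
  ring_unit_inv[OF unit_\<iota>[OF A.mem_zst_monomials(2)]]
  ring_unit_inv[OF unit_\<iota>[OF A.mem_zst_monomials(3)]]
  ring_unit_inv[OF unit_\<iota>[OF A.mem_zst_monomials(4)]]

lemma ring_inv_monomial:
  assumes "c \<noteq> 0"
  shows "ring_inv (\<iota> (scaleA c (z ^ i * s ^ j * t ^ k))) =
    scaleL (inverse c) (ring_inv (\<iota> t) ^ k * (ring_inv (\<iota> s) ^ j * ring_inv (\<iota> z) ^ i))"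
proof (rule ring_inv_eqI)
  have cancel: "a ^ n * (b ^ n * d) = d" if "a * b = 1" for a b d :: 'l and n
    using left_right_inverse_power[OF that, of n] by (simp flip: mult.assoc)
  show "\<iota> (scaleA c (z ^ i * s ^ j * t ^ k)) *
      scaleL (inverse c) (ring_inv (\<iota> t) ^ k * (ring_inv (\<iota> s) ^ j * ring_inv (\<iota> z) ^ i)) = 1"
    using assms cancel[OF \<iota>_inverses(1), of i 1]
    by (simp add: \<iota>.hom_simps \<iota>.cod.scale_mult_left \<iota>.cod.scale_mult_right mult.assoc
        cancel[OF \<iota>_inverses(3)] cancel[OF \<iota>_inverses(5)])
  show "scaleL (inverse c) (ring_inv (\<iota> t) ^ k * (ring_inv (\<iota> s) ^ j * ring_inv (\<iota> z) ^ i)) *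
      \<iota> (scaleA c (z ^ i * s ^ j * t ^ k)) = 1"
    using assms cancel[OF \<iota>_inverses(6), of k 1]
    by (simp add: \<iota>.hom_simps \<iota>.cod.scale_mult_left \<iota>.cod.scale_mult_right mult.assoc
        cancel[OF \<iota>_inverses(2)] cancel[OF \<iota>_inverses(4)])
qed

lemma localization_generated:
  assumes one: "P 1" and add: "\<And>a b. P a \<Longrightarrow> P b \<Longrightarrow> P (a + b)"
    and scale: "\<And>c a. P a \<Longrightarrow> P (scaleL c a)"
    and gens: "\<And>a. P a \<Longrightarrow> P (\<iota> x * a)" "\<And>a. P a \<Longrightarrow> P (\<iota> y * a)"
      "\<And>a. P a \<Longrightarrow> P (\<iota> s * a)" "\<And>a. P a \<Longrightarrow> P (\<iota> t * a)"
    and inverses: "\<And>a. P a \<Longrightarrow> P (ring_inv (\<iota> z) * a)" "\<And>a. P a \<Longrightarrow> P (ring_inv (\<iota> s) * a)"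
      "\<And>a. P a \<Longrightarrow> P (ring_inv (\<iota> t) * a)"
  shows "P b"
proof -
  obtain a d where d: "d \<in> zst_monomials scaleA z s t" "b = \<iota> a * ring_inv (\<iota> d)"
    using ore unfolding is_ore_localization_def by blast
  obtain c i j k where c: "c \<noteq> 0" "d = scaleA c (z ^ i * s ^ j * t ^ k)"
    using d(1) unfolding zst_monomials_def by blast
  have power: "P (u ^ n * w)" if "P w" "\<And>a. P a \<Longrightarrow> P (u * a)" for u w n
    using that by (induction n) (simp_all add: mult.assoc)
  have "P (ring_inv (\<iota> t) ^ k * (ring_inv (\<iota> s) ^ j * (ring_inv (\<iota> z) ^ i * 1)))"
    by (intro power one inverses)
  then have P_inv: "P (ring_inv (\<iota> d))"
    unfolding c(2) ring_inv_monomial[OF c(1)] by (simp add: scale)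
  have "P (\<iota> a * w)" if "P w" for w
    using is_A[unfolded is_A_def]
  proof (induction a rule: presented_by_induct)
    case one
    show ?case
      using that by (simp add: \<iota>.hom_one)
  next
    case (add a b)
    then show ?case
      by (simp add: \<iota>.hom_add distrib_right assms(2))
  next
    case (scale c a)
    then show ?case
      by (simp add: \<iota>.hom_scale \<iota>.cod.scale_mult_left assms(3))
  next
    case (gen g a)
    then show ?case
      using gens by (cases g) (simp_all add: \<iota>.hom_mult mult.assoc)
  qed
  then show ?thesis
    unfolding d(2) using P_inv .
qed

sublocale L: localized_weyl_algebra scaleL p q "\<iota> x" "\<iota> y" "\<iota> z" "\<iota> s" "\<iota> t"
  "ring_inv (\<iota> z)" "ring_inv (\<iota> s)" "ring_inv (\<iota> t)"
proof (unfold_locales, goal_cases)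
  case (18 P b)
  then show ?case
    by (rule localization_generated)
qed (use p0 q0 p_root q_root \<iota>_inverses in
  \<open>simp_all add: A.xy A.z_eq A.st A.sx A.sy A.tx A.ty \<iota>.hom_add \<iota>.hom_scale \<iota>.hom_one \<iota>.hom_diff
     flip: \<iota>.hom_mult\<close>)

end

section \<open>The automorphism group\<close>

context ore_localized_weyl_algebra
begin

text \<open>The presentation supplies a homomorphism on the algebra itself. It extends to the localization
  because it sends \<open>z\<close>, \<open>s\<close> and \<open>t\<close>, hence all denominators, to units.\<close>

lemma endomorphism_exists:
  assumes rel: "a * b = scaleL p (b * a) + 1"
    and comm: "\<iota> s * a = a * \<iota> s" "\<iota> s * b = b * \<iota> s" "\<iota> t * a = a * \<iota> t" "\<iota> t * b = b * \<iota> t"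
    and unit: "ring_unit (a * b - b * a)"
  obtains g where "k_algebra_hom scaleL scaleL g"
    "g (\<iota> x) = a" "g (\<iota> y) = b" "g (\<iota> s) = \<iota> s" "g (\<iota> t) = \<iota> t"
proof -
  obtain f where f: "k_algebra_hom scaleA scaleL f" "f x = a" "f y = b" "f s = \<iota> s" "f t = \<iota> t"
    using is_A_hom_exists[OF is_A \<iota>.cod.k_algebra_axioms rel L.st comm] by blast
  interpret f: k_algebra_hom scaleA scaleL f by fact
  have "f z = a * b - b * a"
    by (simp add: z f.hom_simps f)
  then have "ring_unit (f z)" "ring_unit (f s)" "ring_unit (f t)"
    using unit unit_\<iota> A.mem_zst_monomials by (simp_all add: f)
  then have "ring_unit (f d)" if "d \<in> zst_monomials scaleA z s t" for d
    using that unfolding zst_monomials_def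
    by (auto simp: f.hom_simps intro!: \<iota>.cod.ring_unit_scale ring_unit_mult ring_unit_power)
  then obtain g where "k_algebra_hom scaleL scaleL g" "\<And>a. g (\<iota> a) = f a"
    using ore_localization_extend[OF ore A.zst_monomials_mult A.mem_zst_monomials(1) _ f(1)]
      is_A_normal_monomials[OF is_A A.weyl_algebra_axioms]
    unfolding normal_element_def by blast
  then show thesis
    using that f by simp
qed

lemma ring_unit_scaled_inverse: "ring_unit (scaleL (inverse p) (ring_inv (\<iota> z)))"
  using p0 L.zz' by (intro \<iota>.cod.ring_unit_scale) (auto simp: ring_unit_def)

text \<open>The inverse of \<open>\<psi>\<close> is the endomorphism \<open>\<chi>\<close> with \<open>x \<mapsto> - z\<^sup>-\<^sup>1 y\<close> and \<open>y \<mapsto> x\<close>; both compositions fix the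
  generators.\<close>

lemma psi_minus_exists: "\<exists>\<psi>. is_psi_minus p scaleL (\<iota> x) (\<iota> y) (\<iota> z) (\<iota> s) (\<iota> t) \<psi>"
proof -
  let ?z' = "ring_inv (\<iota> z)"
  let ?w = "scaleL (- inverse p) (?z' * \<iota> x)" and ?w' = "- (?z' * \<iota> y)"
  have comm: "c * (?z' * a) = ?z' * a * c" if "c * ?z' = ?z' * c" "c * a = a * c" for a c
    using \<iota>.cod.skew_commute_mult[of c ?z' 1 a 1] that by simp
  obtain \<psi> where \<psi>: "k_algebra_hom scaleL scaleL \<psi>" "\<psi> (\<iota> x) = \<iota> y" "\<psi> (\<iota> y) = ?w"
    "\<psi> (\<iota> s) = \<iota> s" "\<psi> (\<iota> t) = \<iota> t"
  proof (rule endomorphism_exists[of "\<iota> y" ?w])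
    show "\<iota> y * ?w = scaleL p (?w * \<iota> y) + 1" "ring_unit (\<iota> y * ?w - ?w * \<iota> y)"
      unfolding L.psi_minus_products using L.swapped_products ring_unit_scaled_inverse by simp_all
    show "\<iota> s * ?w = ?w * \<iota> s" "\<iota> t * ?w = ?w * \<iota> t"
      using comm[OF L.s_z' L.sx] comm[OF L.t_z' L.tx]
      by (simp_all add: \<iota>.cod.scale_mult_left \<iota>.cod.scale_mult_right)
  qed (use L.sy L.ty in auto)
  obtain \<chi> where \<chi>: "k_algebra_hom scaleL scaleL \<chi>" "\<chi> (\<iota> x) = ?w'" "\<chi> (\<iota> y) = \<iota> x"
    "\<chi> (\<iota> s) = \<iota> s" "\<chi> (\<iota> t) = \<iota> t"
  proof (rule endomorphism_exists[of ?w' "\<iota> x"])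
    show "?w' * \<iota> x = scaleL p (\<iota> x * ?w') + 1" "ring_unit (?w' * \<iota> x - \<iota> x * ?w')"
      unfolding L.psi_minus_inverse_products
      using L.swapped_products ring_unit_scaled_inverse by simp_all
    show "\<iota> s * ?w' = ?w' * \<iota> s" "\<iota> t * ?w' = ?w' * \<iota> t"
      using comm[OF L.s_z' L.sy] comm[OF L.t_z' L.ty] by simp_all
  qed (use L.sx L.tx in auto)
  interpret \<psi>: k_algebra_hom scaleL scaleL \<psi> by fact
  interpret \<chi>: k_algebra_hom scaleL scaleL \<chi> by fact
  have \<psi>_z: "\<psi> (\<iota> z) = scaleL (inverse p) ?z'"
    using arg_cong[OF L.z_eq, of \<psi>]
    by (simp only: \<psi>.hom_diff \<psi>.hom_mult \<psi>(2,3) L.psi_minus_products L.swapped_products(2))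
  have \<chi>_z: "\<chi> (\<iota> z) = scaleL (inverse p) ?z'"
    using arg_cong[OF L.z_eq, of \<chi>]
    by (simp only: \<chi>.hom_diff \<chi>.hom_mult \<chi>(2,3) L.psi_minus_inverse_products
        L.swapped_products(2))
  have \<psi>_z': "\<psi> ?z' = scaleL p (\<iota> z)" and \<chi>_z': "\<chi> ?z' = scaleL p (\<iota> z)"
    by (rule L.image_inverse[OF \<psi>(1)] L.image_inverse[OF \<chi>(1)];
        simp add: \<psi>_z \<chi>_z \<iota>.cod.scale_mult_left \<iota>.cod.scale_mult_right L.zz' p0)+
  have cancel: "\<iota> z * (?z' * a) = a" for a
    by (simp add: L.zz' flip: mult.assoc)
  have id: "k_algebra_hom scaleL scaleL id"
    by (rule k_algebra_homI) (simp_all add: \<iota>.cod.k_algebra_axioms)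
  have "\<psi> \<circ> \<chi> = id"
    by (rule L.hom_eqI[OF k_algebra_hom_comp[OF \<chi>(1) \<psi>(1)] id])
       (simp_all add: \<psi> \<chi> \<psi>.hom_simps \<psi>_z' \<iota>.cod.scale_mult_left \<iota>.cod.scale_mult_right cancel p0)
  moreover have "\<chi> \<circ> \<psi> = id"
    by (rule L.hom_eqI[OF k_algebra_hom_comp[OF \<psi>(1) \<chi>(1)] id])
       (simp_all add: \<psi> \<chi> \<chi>.hom_simps \<chi>_z' \<iota>.cod.scale_mult_left \<iota>.cod.scale_mult_right cancel p0)
  ultimately have "bij \<psi>"
    by (rule o_bij[rotated])
  then show ?thesis
    using \<psi> \<psi>_z unfolding is_psi_minus_def algebra_Aut_def by auto
qed

lemma psi_minus_unique:
  assumes "is_psi_minus p scaleL (\<iota> x) (\<iota> y) (\<iota> z) (\<iota> s) (\<iota> t) \<psi>"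
    and "is_psi_minus p scaleL (\<iota> x) (\<iota> y) (\<iota> z) (\<iota> s) (\<iota> t) \<chi>"
  shows "\<psi> = \<chi>"
  using assms by (intro L.hom_eqI[of scaleL]) (simp_all add: is_psi_minus_def algebra_Aut_def)

end

lemma group_algebra_Aut:
  assumes "k_algebra scale"
  shows "group (algebra_Aut scale)"
proof (rule groupI)
  fix \<phi> assume "\<phi> \<in> carrier (algebra_Aut scale)"
  then have \<phi>: "k_algebra_hom scale scale \<phi>" "bij \<phi>"
    by (simp_all add: algebra_Aut_def)
  have "inv_into UNIV \<phi> \<circ> \<phi> = id"
    using \<phi>(2) by (simp add: bij_is_inj)
  with k_algebra_hom_inv[OF \<phi>] show "\<exists>\<chi>\<in>carrier (algebra_Aut scale).
      \<chi> \<otimes>\<^bsub>algebra_Aut scale\<^esub> \<phi> = \<one>\<^bsub>algebra_Aut scale\<^esub>"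
    by (auto simp: algebra_Aut_def)
qed (use assms in \<open>auto simp: algebra_Aut_def bij_comp intro: k_algebra_homI k_algebra_hom_comp\<close>)

context ore_localized_weyl_algebra
begin

abbreviation "Aut \<equiv> algebra_Aut scaleL"
abbreviation "positive \<equiv> positive_type scaleL (\<iota> z)"

lemma AutD: "\<phi> \<in> carrier Aut \<Longrightarrow> k_algebra_hom scaleL scaleL \<phi>" "\<phi> \<in> carrier Aut \<Longrightarrow> bij \<phi>"
  by (simp_all add: algebra_Aut_def)

lemma inverse_in_Aut: "\<phi> \<in> carrier Aut \<Longrightarrow> inv_into UNIV \<phi> \<in> carrier Aut"
  using k_algebra_hom_inv[of scaleL \<phi>] by (simp add: algebra_Aut_def)

lemma comp_in_Aut: "\<phi> \<in> carrier Aut \<Longrightarrow> \<chi> \<in> carrier Aut \<Longrightarrow> \<phi> \<circ> \<chi> \<in> carrier Aut"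
  by (auto simp: algebra_Aut_def bij_comp intro: k_algebra_hom_comp)

lemma positive_comp:
  "\<phi> \<in> carrier Aut \<Longrightarrow> \<chi> \<in> carrier Aut \<Longrightarrow> positive (\<phi> \<circ> \<chi>) \<longleftrightarrow> (positive \<phi> \<longleftrightarrow> positive \<chi>)"
  by (intro L.positive_type_comp AutD)

lemma positive_inverse:
  assumes "\<phi> \<in> carrier Aut"
  shows "positive (inv_into UNIV \<phi>) \<longleftrightarrow> positive \<phi>"
proof -
  have "positive id"
    unfolding positive_type_def by (intro exI[of _ 1]) simp
  moreover have "\<phi> \<circ> inv_into UNIV \<phi> = id"
    using AutD(2)[OF assms] by (simp add: bij_is_surj surj_iff[symmetric])
  ultimately show ?thesis
    using positive_comp[OF assms inverse_in_Aut[OF assms]] by simp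
qed

lemma psi_minus_not_positive:
  assumes "is_psi_minus p scaleL (\<iota> x) (\<iota> y) (\<iota> z) (\<iota> s) (\<iota> t) \<psi>"
  shows "\<psi> \<in> carrier Aut" "\<not> positive \<psi>"
proof -
  show "\<psi> \<in> carrier Aut"
    using assms by (simp add: is_psi_minus_def)
  have "negative_type scaleL (\<iota> z) \<psi>"
    using assms p0 unfolding is_psi_minus_def negative_type_def
    by (intro exI[of _ "inverse p"]) simp
  then show "\<not> positive \<psi>"
    using L.positive_or_negative[OF AutD[OF \<open>\<psi> \<in> carrier Aut\<close>]] by simp
qed

definition sign :: "('l \<Rightarrow> 'l) \<Rightarrow> int" where
  "sign \<phi> = (if positive \<phi> then 0 else 1)"

lemma sign_hom: "sign \<in> hom Aut (integer_mod_group 2)"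
  by (rule homI)
     (auto simp: sign_def carrier_integer_mod_group positive_comp[unfolded algebra_Aut_def] algebra_Aut_def)

text \<open>The value \<open>1\<close> is attained at \<open>\<psi>\<close> and the value \<open>0\<close> at \<open>\<psi> \<circ> \<psi>\<close>.\<close>

lemma sign_epi: "sign \<in> epi Aut (integer_mod_group 2)"
proof -
  obtain \<psi> where \<psi>: "is_psi_minus p scaleL (\<iota> x) (\<iota> y) (\<iota> z) (\<iota> s) (\<iota> t) \<psi>"
    using psi_minus_exists by blast
  have "1 \<in> sign ` carrier Aut"
    using psi_minus_not_positive[OF \<psi>] by (force simp: sign_def)
  moreover have "0 \<in> sign ` carrier Aut"
    using psi_minus_not_positive[OF \<psi>] positive_comp[of \<psi> \<psi>] comp_in_Aut[of \<psi> \<psi>]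
    by (force simp: sign_def)
  moreover have "carrier (integer_mod_group 2) = {0, 1}"
    by (auto simp: carrier_integer_mod_group)
  ultimately show ?thesis
    using sign_hom by (auto simp: epi_def sign_def)
qed

lemma kernel_sign: "kernel Aut (integer_mod_group 2) sign = G_plus scaleL (\<iota> z)"
  by (auto simp: kernel_def G_plus_def sign_def)

lemma subgroup_G_plus: "subgroup (G_plus scaleL (\<iota> z)) Aut"
proof -
  interpret group_hom Aut "integer_mod_group 2" sign
    by (intro group_hom.intro group_hom_axioms.intro group_algebra_Aut \<iota>.cod.k_algebra_axioms
        group_integer_mod_group sign_hom)
  show ?thesis
    using subgroup_kernel by (simp add: kernel_sign)
qed

lemma short_exact_sign:
  "short_exact (Aut\<lparr>carrier := G_plus scaleL (\<iota> z)\<rparr>) Aut (integer_mod_group 2) (\<lambda>\<phi>. \<phi>) sign"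
proof -
  interpret group Aut
    by (rule group_algebra_Aut[OF \<iota>.cod.k_algebra_axioms])
  have "group (Aut\<lparr>carrier := G_plus scaleL (\<iota> z)\<rparr>)"
    by (rule subgroup.subgroup_is_group[OF subgroup_G_plus group_algebra_Aut[OF \<iota>.cod.k_algebra_axioms]])
  moreover have "(\<lambda>\<phi>. \<phi>) \<in> mon (Aut\<lparr>carrier := G_plus scaleL (\<iota> z)\<rparr>) Aut"
    by (auto simp: mon_def hom_def G_plus_def)
  ultimately show ?thesis
    unfolding short_exact_def using sign_epi kernel_sign is_group by simp
qed

lemma negative_factorization:
  assumes \<psi>: "is_psi_minus p scaleL (\<iota> x) (\<iota> y) (\<iota> z) (\<iota> s) (\<iota> t) \<psi>"
    and \<phi>: "\<phi> \<in> carrier Aut" "\<not> positive \<phi>"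
  shows "\<psi> \<circ> \<phi> \<in> G_plus scaleL (\<iota> z)" "\<phi> = inv_into UNIV \<psi> \<circ> (\<psi> \<circ> \<phi>)"
proof -
  note \<psi>' = psi_minus_not_positive[OF \<psi>]
  show "\<psi> \<circ> \<phi> \<in> G_plus scaleL (\<iota> z)"
    using positive_comp[OF \<psi>'(1) \<phi>(1)] comp_in_Aut[OF \<psi>'(1) \<phi>(1)] \<psi>'(2) \<phi>(2)
    by (simp add: G_plus_def)
  show "\<phi> = inv_into UNIV \<psi> \<circ> (\<psi> \<circ> \<phi>)"
    using AutD(2)[OF \<psi>'(1)] by (simp add: bij_is_inj flip: comp_assoc)
qed

lemma G_minus_eq:
  assumes \<psi>: "is_psi_minus p scaleL (\<iota> x) (\<iota> y) (\<iota> z) (\<iota> s) (\<iota> t) \<psi>"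
  shows "G_minus scaleL (\<iota> z) \<psi> = {\<phi> \<in> carrier Aut. \<not> positive \<phi>}"
proof -
  note \<psi>' = psi_minus_not_positive[OF \<psi>]
  note inv = inverse_in_Aut[OF \<psi>'(1)] positive_inverse[OF \<psi>'(1)]
  have "inv_into UNIV \<psi> \<circ> \<phi> \<in> carrier Aut \<and> \<not> positive (inv_into UNIV \<psi> \<circ> \<phi>)"
    if "\<phi> \<in> G_plus scaleL (\<iota> z)" for \<phi>
    using that positive_comp[OF inv(1)] comp_in_Aut[OF inv(1)] inv(2) \<psi>'(2)
    by (simp add: G_plus_def)
  then show ?thesis
    unfolding G_minus_def using negative_factorization[OF \<psi>] by blast
qed

end

theorem theorem3p2:
  fixes p q :: "'k::field"
    and scaleA :: "'k \<Rightarrow> 'a::ring_1 \<Rightarrow> 'a"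
    and scaleL :: "'k \<Rightarrow> 'l::ring_1 \<Rightarrow> 'l"
    and x y z s t :: 'a
    and \<iota> :: "'a \<Rightarrow> 'l"
  assumes "p \<noteq> 0" and "q \<noteq> 0"
    and "\<forall>n::nat. n > 0 \<longrightarrow> p ^ n \<noteq> 1"
    and "\<forall>n::nat. n > 0 \<longrightarrow> q ^ n \<noteq> 1"
    and "is_A p q scaleA x y s t"
    and "z = x * y - y * x"
    and "is_ore_localization scaleA scaleL (zst_monomials scaleA z s t) \<iota>"
  shows "group (algebra_Aut scaleL) \<and>
    subgroup (G_plus scaleL (\<iota> z)) (algebra_Aut scaleL) \<and>
    (\<exists>!\<psi>. is_psi_minus p scaleL (\<iota> x) (\<iota> y) (\<iota> z) (\<iota> s) (\<iota> t) \<psi>) \<and>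
    (\<forall>\<psi>. is_psi_minus p scaleL (\<iota> x) (\<iota> y) (\<iota> z) (\<iota> s) (\<iota> t) \<psi> \<longrightarrow>
       inv_into UNIV \<psi> \<in> carrier (algebra_Aut scaleL) \<and>
       negative_type scaleL (\<iota> z) (inv_into UNIV \<psi>) \<and>
       (\<forall>\<phi> \<in> carrier (algebra_Aut scaleL).
          positive_type scaleL (\<iota> z) \<phi> \<or>
          (\<exists>\<phi>\<^sub>p \<in> carrier (algebra_Aut scaleL).
             positive_type scaleL (\<iota> z) \<phi>\<^sub>p \<and> \<phi> = inv_into UNIV \<psi> \<circ> \<phi>\<^sub>p)) \<and>
       carrier (algebra_Aut scaleL) = G_plus scaleL (\<iota> z) \<union> G_minus scaleL (\<iota> z) \<psi> \<and>
       G_plus scaleL (\<iota> z) \<inter> G_minus scaleL (\<iota> z) \<psi> = {}) \<and>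
    (\<exists>\<sigma>. short_exact
       ((algebra_Aut scaleL)\<lparr>carrier := G_plus scaleL (\<iota> z)\<rparr>)
       (algebra_Aut scaleL)
       (integer_mod_group 2)
       (\<lambda>\<phi>. \<phi>) \<sigma>)"
proof (intro conjI allI impI ballI)
  interpret ore_localized_weyl_algebra p q scaleA scaleL x y z s t \<iota>
    using assms by (rule ore_localized_weyl_algebra.intro)
  show "group Aut"
    by (rule group_algebra_Aut[OF \<iota>.cod.k_algebra_axioms])
  show "subgroup (G_plus scaleL (\<iota> z)) Aut"
    by (rule subgroup_G_plus)
  show "\<exists>!\<psi>. is_psi_minus p scaleL (\<iota> x) (\<iota> y) (\<iota> z) (\<iota> s) (\<iota> t) \<psi>"
    using psi_minus_exists psi_minus_unique by blast
  show "\<exists>\<sigma>. short_exact (Aut\<lparr>carrier := G_plus scaleL (\<iota> z)\<rparr>) Aut (integer_mod_group 2) (\<lambda>\<phi>. \<phi>) \<sigma>"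
    using short_exact_sign by blast
  fix \<psi> assume \<psi>: "is_psi_minus p scaleL (\<iota> x) (\<iota> y) (\<iota> z) (\<iota> s) (\<iota> t) \<psi>"
  note \<psi>' = psi_minus_not_positive[OF \<psi>]
  show inv: "inv_into UNIV \<psi> \<in> carrier Aut"
    by (rule inverse_in_Aut[OF \<psi>'(1)])
  show "negative_type scaleL (\<iota> z) (inv_into UNIV \<psi>)"
    using L.positive_or_negative[OF AutD[OF inv]] positive_inverse[OF \<psi>'(1)] \<psi>'(2) by simp
  show "positive \<phi> \<or> (\<exists>\<phi>\<^sub>p\<in>carrier Aut. positive \<phi>\<^sub>p \<and> \<phi> = inv_into UNIV \<psi> \<circ> \<phi>\<^sub>p)"
    if "\<phi> \<in> carrier Aut" for \<phi>
    using negative_factorization[OF \<psi> that] unfolding G_plus_def by blast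
  show "carrier Aut = G_plus scaleL (\<iota> z) \<union> G_minus scaleL (\<iota> z) \<psi>"
    "G_plus scaleL (\<iota> z) \<inter> G_minus scaleL (\<iota> z) \<psi> = {}"
    by (auto simp: G_minus_eq[OF \<psi>] G_plus_def)
qed

end
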